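(* Let $X$ and $Y$ be metric spaces. Then the categories $\mathsf{EPMet}_X^{\mathrm{Aut}\,Y}$ and $\mathsf{core}\,\mathsf{Fib}_X^Y$ are equivalent. Hence metric fibrations over $X$ with fiber $Y$ are classified by homomorphisms to $\mathrm{Aut}\,Y$: for every $x_0\in X$, the groupoids $\mathsf{core}\,\mathsf{Fib}_X^Y$ and $\mathsf{Hom}(\pi_1^m(X,x_0),\mathrm{Aut}\,Y)$ are equivalent.
   Context: A Lipschitz map is a map $f$ with $d(fx,fx')\le d(x,x')$ (constant $1$). An isometry is a distance-preserving bijection. Metric spaces have finite distances; extended metric spaces satisfy the same axioms but allow the distance value $\infty$. An extended metric group is a group $\mathcal G$ with an extended metric such that multiplication is Lipschitz for the $L^1$-product $d((g,h),(g',h'))=d(g,g')+d(h,h')$; it is a metric group if all distances are finite. A homomorphism is a Lipschitz group homomorphism. $\mathrm{Aut}\,Y$ is the group of all isometries $Y\to Y$ with $d_{\mathrm{Aut}\,Y}(f,g)=\sup_{y\in Y}d_Y(fy,gy)\in[0,\infty]$; it is an extended metric group. For an extended metric group $\mathcal G$, an extended $\mathcal G$-metric action $F$ on $X$ assigns $Fx=\mathcal G$ to each $x\in X$ and an element $F_{xx'}\in\mathcal G$ to all $x,x'\in X$ such that $F_{xx}=e$, $F_{xx'}=F_{x'x}^{-1}$ and $d_{\mathcal G}(F_{x'x''}F_{xx'},F_{xx''})\le d_X(x,x')+d_X(x',x'')-d_X(x,x'')$ for all $x,x',x''\in X$. An extended $\mathcal G$-metric transformation $\theta:F\Rightarrow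 F'$ is a family $\{\theta_x\in\mathcal G\}_{x\in X}$ with $F'_{xx'}\theta_x=\theta_{x'}F_{xx'}$; composition is componentwise multiplication. $\mathsf{EPMet}_X^{\mathcal G}$ is the resulting category. A metric fibration over $X$ is a Lipschitz map $\pi:E\to X$ of metric spaces such that for all $\varepsilon\in E$, $x\in X$ there is a unique $\varepsilon_x\in\pi^{-1}x$ with $d_E(\varepsilon,\varepsilon_x)=d_X(\pi\varepsilon,x)$ and $d_E(\varepsilon,\varepsilon')=d_E(\varepsilon,\varepsilon_x)+d_E(\varepsilon_x,\varepsilon')$ for all $\varepsilon'\in\pi^{-1}x$. A morphism is a Lipschitz map commuting with the projections to $X$. $\mathsf{Fib}_X^Y$ is the category of metric fibrations $\pi$ over $X$ with $\pi^{-1}x$ isometric to $Y$ for all $x\in X$ (full subcategory of all metric fibrations over $X$). $\mathsf{core}\,C$ is the groupoid with the same objects as $C$ whose morphisms are the isomorphisms of $C$. For extended metric groups $\mathcal H,\mathcal G$, $\mathsf{Hom}(\mathcal H,\mathcal G)$ is the groupoid whose objects are the homomorphisms $\mathcal H\to\mathcal G$, whose morphisms $\varphi\to\psi$ are the $h\in\mathcal G$ with $\varphi=h^{-1}\psi h$, with composition $h'\circ h=h'h$. Metric fundamental group: for $x\in X$ let $P_n(X,x)=\{(x,x_1,\dots,x_n,x)\in X^{n+2}\}$ and $P(X,x)=\bigcup_{n\ge0}P_n(X,x)$. Form a weighted graph with vertex set $P(X,x)$: $\{u,v\}$ is an edge iff, for some $n\ge0$, $u=(x,u_1,\dots,u_n,x)\in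 P_n(X,x)$, $v=(x,v_1,\dots,v_{n+1},x)\in P_{n+1}(X,x)$ and there is $0\le j\le n$ with $u_i=v_i$ for $1\le i\le j$ and $u_i=v_{i+1}$ for $j+1\le i\le n$. With $v_0=v_{n+2}=x$, its weight is $d_X(v_j,v_{j+1})+d_X(v_{j+1},v_{j+2})-d_X(v_j,v_{j+2})$ if $v_j\ne v_{j+2}$, and $0$ if $v_j=v_{j+2}$. Give $P(X,x)$ the pseudometric which is the infimum over finite paths of the sums of edge weights. $\pi_1^m(X,x)$ is the metric space obtained by identifying points at distance $0$; it is a metric group under $[(x,u_1,\dots,u_n,x)]\bullet[(x,v_1,\dots,v_k,x)]=[(x,u_1,\dots,u_n,x,v_1,\dots,v_k,x)]$ with unit $[(x,x)]$. *)

theory Defs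
  imports "HOL-Analysis.Analysis" "HOL-Algebra.Group"
begin

section \<open>Categories and their equivalence\<close>

text \<open>Hom-sets are not required to be disjoint; therefore composition and the arrow part of a
  functor take the objects involved as additional arguments. \<open>cat_comp C a b c g f\<close> is the
  composite of \<open>f : a \<rightarrow> b\<close> followed by \<open>g : b \<rightarrow> c\<close>.\<close>

record ('o, 'm) cat =
  cat_obj :: "'o set"
  cat_hom :: "'o \<Rightarrow> 'o \<Rightarrow> 'm set"
  cat_id :: "'o \<Rightarrow> 'm"
  cat_comp :: "'o \<Rightarrow> 'o \<Rightarrow> 'o \<Rightarrow> 'm \<Rightarrow> 'm \<Rightarrow> 'm"

definition is_category :: "('o, 'm) cat \<Rightarrow> bool" where
  "is_category C \<longleftrightarrow>
     (\<forall>a\<in>cat_obj C. cat_id C a \<in> cat_hom C a a) \<and>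
     (\<forall>a\<in>cat_obj C. \<forall>b\<in>cat_obj C. \<forall>c\<in>cat_obj C. \<forall>f\<in>cat_hom C a b. \<forall>g\<in>cat_hom C b c.
        cat_comp C a b c g f \<in> cat_hom C a c) \<and>
     (\<forall>a\<in>cat_obj C. \<forall>b\<in>cat_obj C. \<forall>f\<in>cat_hom C a b.
        cat_comp C a a b f (cat_id C a) = f \<and> cat_comp C a b b (cat_id C b) f = f) \<and>
     (\<forall>a\<in>cat_obj C. \<forall>b\<in>cat_obj C. \<forall>c\<in>cat_obj C. \<forall>d\<in>cat_obj C.
        \<forall>f\<in>cat_hom C a b. \<forall>g\<in>cat_hom C b c. \<forall>h\<in>cat_hom C c d.
        cat_comp C a c d h (cat_comp C a b c g f) = cat_comp C a b d (cat_comp C b c d h g) f)"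

definition cat_isos :: "('o, 'm) cat \<Rightarrow> 'o \<Rightarrow> 'o \<Rightarrow> 'm set" where
  "cat_isos C a b =
     {f \<in> cat_hom C a b. \<exists>g\<in>cat_hom C b a.
        cat_comp C a b a g f = cat_id C a \<and> cat_comp C b a b f g = cat_id C b}"

definition core :: "('o, 'm) cat \<Rightarrow> ('o, 'm) cat" where
  "core C = C\<lparr>cat_hom := cat_isos C\<rparr>"

definition is_functor ::
  "('o, 'm) cat \<Rightarrow> ('p, 'n) cat \<Rightarrow> ('o \<Rightarrow> 'p) \<Rightarrow> ('o \<Rightarrow> 'o \<Rightarrow> 'm \<Rightarrow> 'n) \<Rightarrow> bool" where
  "is_functor C D F Fm \<longleftrightarrow>
     is_category C \<and> is_category D \<and>
     (\<forall>a\<in>cat_obj C. F a \<in> cat_obj D) \<and>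
     (\<forall>a\<in>cat_obj C. \<forall>b\<in>cat_obj C. \<forall>f\<in>cat_hom C a b. Fm a b f \<in> cat_hom D (F a) (F b)) \<and>
     (\<forall>a\<in>cat_obj C. Fm a a (cat_id C a) = cat_id D (F a)) \<and>
     (\<forall>a\<in>cat_obj C. \<forall>b\<in>cat_obj C. \<forall>c\<in>cat_obj C. \<forall>f\<in>cat_hom C a b. \<forall>g\<in>cat_hom C b c.
        Fm a c (cat_comp C a b c g f) = cat_comp D (F a) (F b) (F c) (Fm b c g) (Fm a b f))"

definition naturally_isomorphic ::
  "('o, 'm) cat \<Rightarrow> ('p, 'n) cat \<Rightarrow> ('o \<Rightarrow> 'p) \<Rightarrow> ('o \<Rightarrow> 'o \<Rightarrow> 'm \<Rightarrow> 'n) \<Rightarrow>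
   ('o \<Rightarrow> 'p) \<Rightarrow> ('o \<Rightarrow> 'o \<Rightarrow> 'm \<Rightarrow> 'n) \<Rightarrow> bool" where
  "naturally_isomorphic C D F Fm G Gm \<longleftrightarrow>
     (\<exists>\<eta>. (\<forall>a\<in>cat_obj C. \<eta> a \<in> cat_isos D (F a) (G a)) \<and>
          (\<forall>a\<in>cat_obj C. \<forall>b\<in>cat_obj C. \<forall>f\<in>cat_hom C a b.
             cat_comp D (F a) (F b) (G b) (\<eta> b) (Fm a b f) =
             cat_comp D (F a) (G a) (G b) (Gm a b f) (\<eta> a)))"

definition equivalent_categories :: "('o, 'm) cat \<Rightarrow> ('p, 'n) cat \<Rightarrow> bool" where
  "equivalent_categories C D \<longleftrightarrow>
     (\<exists>F Fm G Gm. is_functor C D F Fm \<and> is_functor D C G Gm \<and>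
        naturally_isomorphic C C (\<lambda>a. G (F a)) (\<lambda>a b f. Gm (F a) (F b) (Fm a b f))
          (\<lambda>a. a) (\<lambda>a b f. f) \<and>
        naturally_isomorphic D D (\<lambda>a. F (G a)) (\<lambda>a b f. Fm (G a) (G b) (Gm a b f))
          (\<lambda>a. a) (\<lambda>a b f. f))"


section \<open>Lipschitz maps and isometries\<close>

text \<open>Maps are extensional, so that equality of HOL functions is equality of maps.\<close>

definition lipschitz_maps :: "'a metric \<Rightarrow> 'b metric \<Rightarrow> ('a \<Rightarrow> 'b) set" where
  "lipschitz_maps M N =
     {f \<in> mspace M \<rightarrow>\<^sub>E mspace N. \<forall>x\<in>mspace M. \<forall>x'\<in>mspace M. mdist N (f x) (f x') \<le> mdist M x x'}"

definition isometries :: "'a metric \<Rightarrow> 'b metric \<Rightarrow> ('a \<Rightarrow> 'b) set" where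
  "isometries M N =
     {f \<in> extensional (mspace M). bij_betw f (mspace M) (mspace N) \<and>
        (\<forall>x\<in>mspace M. \<forall>x'\<in>mspace M. mdist N (f x) (f x') = mdist M x x')}"

definition isometric :: "'a metric \<Rightarrow> 'b metric \<Rightarrow> bool" where
  "isometric M N \<longleftrightarrow> isometries M N \<noteq> {}"


section \<open>Extended metric groups\<close>

record 'g emgroup = "'g monoid" +
  edist :: "'g \<Rightarrow> 'g \<Rightarrow> ennreal"

locale extended_metric_group = group G for G :: "('g, 'm) emgroup_scheme" (structure) +
  assumes edist_eq_0_iff:
      "\<lbrakk>g \<in> carrier G; h \<in> carrier G\<rbrakk> \<Longrightarrow> edist G g h = 0 \<longleftrightarrow> g = h"
    and edist_commute:
      "\<lbrakk>g \<in> carrier G; h \<in> carrier G\<rbrakk> \<Longrightarrow> edist G g h = edist G h g"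
    and edist_triangle:
      "\<lbrakk>g \<in> carrier G; h \<in> carrier G; k \<in> carrier G\<rbrakk> \<Longrightarrow>
         edist G g k \<le> edist G g h + edist G h k"
    and mult_lipschitz:
      "\<lbrakk>g \<in> carrier G; h \<in> carrier G; g' \<in> carrier G; h' \<in> carrier G\<rbrakk> \<Longrightarrow>
         edist G (g \<otimes> h) (g' \<otimes> h') \<le> edist G g g' + edist G h h'"

locale metric_group = extended_metric_group +
  assumes edist_finite: "\<lbrakk>g \<in> carrier G; h \<in> carrier G\<rbrakk> \<Longrightarrow> edist G g h < \<infinity>"

definition emgroup_hom :: "('h, 'm) emgroup_scheme \<Rightarrow> ('g, 'n) emgroup_scheme \<Rightarrow> ('h \<Rightarrow> 'g) set" where
  "emgroup_hom H G =
     {\<phi> \<in> extensional (carrier H) \<inter> hom H G.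
        \<forall>a\<in>carrier H. \<forall>b\<in>carrier H. edist G (\<phi> a) (\<phi> b) \<le> edist H a b}"

definition Aut :: "'y metric \<Rightarrow> ('y \<Rightarrow> 'y) emgroup" where
  "Aut Y = \<lparr>carrier = isometries Y Y,
            mult = (\<lambda>g f. compose (mspace Y) g f),
            one = (\<lambda>y\<in>mspace Y. y),
            edist = (\<lambda>f g. SUP y\<in>mspace Y. ennreal (mdist Y (f y) (g y)))\<rparr>"

definition Hom :: "('h, 'm) emgroup_scheme \<Rightarrow> ('g, 'n) emgroup_scheme \<Rightarrow> ('h \<Rightarrow> 'g, 'g) cat" where
  "Hom H G =
     \<lparr>cat_obj = emgroup_hom H G,
      cat_hom = (\<lambda>\<phi> \<psi>. {h \<in> carrier G. \<forall>a\<in>carrier H. \<phi> a = inv\<^bsub>G\<^esub> h \<otimes>\<^bsub>G\<^esub> \<psi> a \<otimes>\<^bsub>G\<^esub> h}),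
      cat_id = (\<lambda>\<phi>. \<one>\<^bsub>G\<^esub>),
      cat_comp = (\<lambda>\<phi> \<psi> \<xi> h' h. h' \<otimes>\<^bsub>G\<^esub> h)\<rparr>"


section \<open>Extended metric actions\<close>

text \<open>\<open>F x x'\<close> is the element $F_{xx'}$. The right hand side of the last inequality is
  nonnegative by the triangle inequality.\<close>

definition ext_metric_actions ::
  "'x metric \<Rightarrow> ('g, 'm) emgroup_scheme \<Rightarrow> ('x \<Rightarrow> 'x \<Rightarrow> 'g) set" where
  "ext_metric_actions X G =
     {F \<in> mspace X \<rightarrow>\<^sub>E (mspace X \<rightarrow>\<^sub>E carrier G).
        (\<forall>x\<in>mspace X. F x x = \<one>\<^bsub>G\<^esub>) \<and>
        (\<forall>x\<in>mspace X. \<forall>x'\<in>mspace X. F x x' = inv\<^bsub>G\<^esub> (F x' x)) \<and>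
        (\<forall>x\<in>mspace X. \<forall>x'\<in>mspace X. \<forall>x''\<in>mspace X.
           edist G (F x' x'' \<otimes>\<^bsub>G\<^esub> F x x') (F x x'')
             \<le> ennreal (mdist X x x' + mdist X x' x'' - mdist X x x''))}"

definition EPMet :: "'x metric \<Rightarrow> ('g, 'm) emgroup_scheme \<Rightarrow> ('x \<Rightarrow> 'x \<Rightarrow> 'g, 'x \<Rightarrow> 'g) cat" where
  "EPMet X G =
     \<lparr>cat_obj = ext_metric_actions X G,
      cat_hom = (\<lambda>F F'. {\<theta> \<in> mspace X \<rightarrow>\<^sub>E carrier G.
         \<forall>x\<in>mspace X. \<forall>x'\<in>mspace X. F' x x' \<otimes>\<^bsub>G\<^esub> \<theta> x = \<theta> x' \<otimes>\<^bsub>G\<^esub> F x x'}),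
      cat_id = (\<lambda>F. \<lambda>x\<in>mspace X. \<one>\<^bsub>G\<^esub>),
      cat_comp = (\<lambda>F F' F'' \<theta>' \<theta>. \<lambda>x\<in>mspace X. \<theta>' x \<otimes>\<^bsub>G\<^esub> \<theta> x)\<rparr>"


section \<open>Metric fibrations\<close>

text \<open>An object over \<open>X\<close> is a pair of a metric space \<open>E\<close>, carried by a subset of the type
  \<open>'e\<close>, and a projection \<open>\<pi>\<close>. The type \<open>'e\<close> acts as the universe of points of total spaces.
  A fibration over \<open>X\<close> with fiber \<open>Y\<close> has as many points as \<open>X \<times> Y\<close>, so every such fibration is
  isomorphic to one carried by \<open>'e\<close> as soon as \<open>X \<times> Y\<close> injects into \<open>'e\<close>.\<close>

type_synonym ('x, 'e) fibration = "'e metric \<times> ('e \<Rightarrow> 'x)"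

definition fiber :: "'e metric \<Rightarrow> ('e \<Rightarrow> 'x) \<Rightarrow> 'x \<Rightarrow> 'e set" where
  "fiber E \<pi> x = {\<epsilon> \<in> mspace E. \<pi> \<epsilon> = x}"

definition metric_fibrations :: "'x metric \<Rightarrow> ('x, 'e) fibration set" where
  "metric_fibrations X =
     {(E, \<pi>). \<pi> \<in> lipschitz_maps E X \<and>
        (\<forall>\<epsilon>\<in>mspace E. \<forall>x\<in>mspace X.
           \<exists>!\<epsilon>x. \<epsilon>x \<in> fiber E \<pi> x \<and>
             mdist E \<epsilon> \<epsilon>x = mdist X (\<pi> \<epsilon>) x \<and>
             (\<forall>\<epsilon>'\<in>fiber E \<pi> x. mdist E \<epsilon> \<epsilon>' = mdist E \<epsilon> \<epsilon>x + mdist E \<epsilon>x \<epsilon>'))}"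

definition MFib :: "'x metric \<Rightarrow> (('x, 'e) fibration, 'e \<Rightarrow> 'e) cat" where
  "MFib X =
     \<lparr>cat_obj = metric_fibrations X,
      cat_hom = (\<lambda>(E, \<pi>) (E', \<pi>').
         {f \<in> lipschitz_maps E E'. \<forall>\<epsilon>\<in>mspace E. \<pi>' (f \<epsilon>) = \<pi> \<epsilon>}),
      cat_id = (\<lambda>(E, \<pi>). \<lambda>\<epsilon>\<in>mspace E. \<epsilon>),
      cat_comp = (\<lambda>(E, \<pi>) p' p'' g f. compose (mspace E) g f)\<rparr>"

definition Fib :: "'x metric \<Rightarrow> 'y metric \<Rightarrow> (('x, 'e) fibration, 'e \<Rightarrow> 'e) cat" where
  "Fib X Y = (MFib X)\<lparr>cat_obj :=
     {(E, \<pi>) \<in> metric_fibrations X. \<forall>x\<in>mspace X. isometric (submetric E (fiber E \<pi> x)) Y}\<rparr>"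


section \<open>The metric fundamental group\<close>

definition loops_n :: "'x metric \<Rightarrow> 'x \<Rightarrow> nat \<Rightarrow> 'x list set" where
  "loops_n X x n =
     {u. length u = n + 2 \<and> set u \<subseteq> mspace X \<and> u ! 0 = x \<and> u ! (n + 1) = x}"

definition loops :: "'x metric \<Rightarrow> 'x \<Rightarrow> 'x list set" where
  "loops X x = (\<Union>n. loops_n X x n)"

text \<open>\<open>loop_edge X x u v w\<close>: there is an edge of weight \<open>w\<close> between \<open>u\<close> and the longer loop \<open>v\<close>.
  The index \<open>j\<close> is not unique if the deleted entry lies in a block of equal entries of \<open>v\<close>, but
  then every possible \<open>j\<close> gives weight \<open>0\<close>.\<close>

definition loop_edge :: "'x metric \<Rightarrow> 'x \<Rightarrow> 'x list \<Rightarrow> 'x list \<Rightarrow> real \<Rightarrow> bool" where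
  "loop_edge X x u v w \<longleftrightarrow>
     (\<exists>n j. u \<in> loops_n X x n \<and> v \<in> loops_n X x (n + 1) \<and> j \<le> n \<and>
        (\<forall>i. 1 \<le> i \<and> i \<le> j \<longrightarrow> u ! i = v ! i) \<and>
        (\<forall>i. j + 1 \<le> i \<and> i \<le> n \<longrightarrow> u ! i = v ! (i + 1)) \<and>
        w = (if v ! j \<noteq> v ! (j + 2)
             then mdist X (v ! j) (v ! (j + 1)) + mdist X (v ! (j + 1)) (v ! (j + 2))
                  - mdist X (v ! j) (v ! (j + 2))
             else 0))"

text \<open>\<open>loop_path X x u s v\<close>: some finite edge path from \<open>u\<close> to \<open>v\<close> has total weight \<open>s\<close>.\<close>

inductive loop_path :: "'x metric \<Rightarrow> 'x \<Rightarrow> 'x list \<Rightarrow> real \<Rightarrow> 'x list \<Rightarrow> bool"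
  for X :: "'x metric" and x :: 'x where
  refl: "u \<in> loops X x \<Longrightarrow> loop_path X x u 0 u"
| step: "\<lbrakk>loop_path X x u s v; loop_edge X x v v' w \<or> loop_edge X x v' v w\<rbrakk> \<Longrightarrow>
         loop_path X x u (s + w) v'"

definition loop_dist :: "'x metric \<Rightarrow> 'x \<Rightarrow> 'x list \<Rightarrow> 'x list \<Rightarrow> ennreal" where
  "loop_dist X x u v = Inf {ennreal s | s. loop_path X x u s v}"

definition loop_rel :: "'x metric \<Rightarrow> 'x \<Rightarrow> ('x list \<times> 'x list) set" where
  "loop_rel X x = {(u, v) \<in> loops X x \<times> loops X x. loop_dist X x u v = 0}"

text \<open>\<open>u @ tl v\<close> joins two loops, keeping the common base point between them once.\<close>

definition pi1m :: "'x metric \<Rightarrow> 'x \<Rightarrow> 'x list set emgroup" where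
  "pi1m X x =
     \<lparr>carrier = loops X x // loop_rel X x,
      mult = (\<lambda>A B. \<Union>u\<in>A. \<Union>v\<in>B. loop_rel X x `` {u @ tl v}),
      one = loop_rel X x `` {[x, x]},
      edist = (\<lambda>A B. the_elem (\<Union>u\<in>A. \<Union>v\<in>B. {loop_dist X x u v}))\<rparr>"


section \<open>Isometry groups are extended metric groups\<close>

lemma extended_metric_group_Aut: "extended_metric_group (Aut Y)"
proof -
  have "group (Aut Y)"
  proof (rule groupI)
    fix f g assume "f \<in> carrier (Aut Y)" "g \<in> carrier (Aut Y)"
    then show "f \<otimes>\<^bsub>Aut Y\<^esub> g \<in> carrier (Aut Y)"
      by (auto simp: Aut_def isometries_def compose_def bij_betw_apply
          intro: bij_betw_trans[unfolded comp_def])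
  next
    show "\<one>\<^bsub>Aut Y\<^esub> \<in> carrier (Aut Y)"
      by (auto simp: Aut_def isometries_def bij_betw_def inj_on_def)
  next
    fix f g h assume "f \<in> carrier (Aut Y)" "g \<in> carrier (Aut Y)" "h \<in> carrier (Aut Y)"
    then show "f \<otimes>\<^bsub>Aut Y\<^esub> g \<otimes>\<^bsub>Aut Y\<^esub> h = f \<otimes>\<^bsub>Aut Y\<^esub> (g \<otimes>\<^bsub>Aut Y\<^esub> h)"
      by (auto simp: Aut_def isometries_def compose_def bij_betw_apply)
  next
    fix f assume "f \<in> carrier (Aut Y)"
    then show "\<one>\<^bsub>Aut Y\<^esub> \<otimes>\<^bsub>Aut Y\<^esub> f = f"
      by (auto simp: Aut_def isometries_def compose_def bij_betw_apply extensional_def)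
  next
    fix f assume f: "f \<in> carrier (Aut Y)"
    define g where "g = restrict (inv_into (mspace Y) f) (mspace Y)"
    have b: "bij_betw f (mspace Y) (mspace Y)"
      using f by (simp add: Aut_def isometries_def)
    have g1: "g y \<in> mspace Y" "f (g y) = y" if "y \<in> mspace Y" for y
      using that b by (auto simp: g_def bij_betw_def inv_into_into f_inv_into_f)
    have "bij_betw g (mspace Y) (mspace Y)"
      unfolding g_def by (rule bij_betw_restrict_eq[THEN iffD2]) (rule bij_betw_inv_into[OF b])
    moreover have "mdist Y (g y) (g y') = mdist Y y y'" if "y \<in> mspace Y" "y' \<in> mspace Y" for y y'
      using f g1 that by (auto simp: Aut_def isometries_def) metis
    ultimately have "g \<in> carrier (Aut Y)"
      by (auto simp: Aut_def isometries_def g_def)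
    moreover have "g \<otimes>\<^bsub>Aut Y\<^esub> f = \<one>\<^bsub>Aut Y\<^esub>"
      using b by (auto simp: Aut_def g_def compose_def bij_betw_apply bij_betw_def intro!: restrict_ext)
    ultimately show "\<exists>g\<in>carrier (Aut Y). g \<otimes>\<^bsub>Aut Y\<^esub> f = \<one>\<^bsub>Aut Y\<^esub>" by blast
  qed
  moreover have "edist (Aut Y) f g = 0 \<longleftrightarrow> f = g"
    if "f \<in> carrier (Aut Y)" "g \<in> carrier (Aut Y)" for f g
  proof
    assume 0: "edist (Aut Y) f g = 0"
    have "f y = g y" if y: "y \<in> mspace Y" for y
    proof -
      have "ennreal (mdist Y (f y) (g y)) = 0"
        using 0 SUP_upper[OF y, of "\<lambda>y. ennreal (mdist Y (f y) (g y))"] by (auto simp: Aut_def)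
      then have "mdist Y (f y) (g y) = 0" by (simp add: ennreal_eq_0_iff antisym)
      moreover have "f y \<in> mspace Y" "g y \<in> mspace Y"
        using y \<open>f \<in> _\<close> \<open>g \<in> _\<close> by (auto simp: Aut_def isometries_def bij_betw_apply)
      ultimately show ?thesis by simp
    qed
    then show "f = g"
      using that by (intro extensionalityI[of _ "mspace Y"]) (auto simp: Aut_def isometries_def)
  next
    assume "f = g"
    then show "edist (Aut Y) f g = 0"
      using that by (auto simp: Aut_def isometries_def bij_betw_apply intro!: SUP_eq_const SUP_least antisym)
  qed
  moreover have "edist (Aut Y) f h \<le> edist (Aut Y) f g + edist (Aut Y) g h"
    if "f \<in> carrier (Aut Y)" "g \<in> carrier (Aut Y)" "h \<in> carrier (Aut Y)" for f g h
  proof -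
    have "ennreal (mdist Y (f y) (h y)) \<le> (SUP y\<in>mspace Y. ennreal (mdist Y (f y) (g y)))
       + (SUP y\<in>mspace Y. ennreal (mdist Y (g y) (h y)))" if y: "y \<in> mspace Y" for y
    proof -
      have "ennreal (mdist Y (f y) (h y)) \<le> ennreal (mdist Y (f y) (g y)) + ennreal (mdist Y (g y) (h y))"
        using that \<open>f \<in> _\<close> \<open>g \<in> _\<close> \<open>h \<in> _\<close>
        by (auto simp: Aut_def isometries_def bij_betw_apply mdist_triangle simp flip: ennreal_plus)
      also have "\<dots> \<le> (SUP y\<in>mspace Y. ennreal (mdist Y (f y) (g y)))
       + (SUP y\<in>mspace Y. ennreal (mdist Y (g y) (h y)))"
        by (intro add_mono SUP_upper y)
      finally show ?thesis .
    qed
    then show ?thesis by (auto simp: Aut_def intro: SUP_least)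
  qed
  moreover have "edist (Aut Y) (f \<otimes>\<^bsub>Aut Y\<^esub> g) (f' \<otimes>\<^bsub>Aut Y\<^esub> g') \<le> edist (Aut Y) f f' + edist (Aut Y) g g'"
    if "f \<in> carrier (Aut Y)" "g \<in> carrier (Aut Y)" "f' \<in> carrier (Aut Y)" "g' \<in> carrier (Aut Y)"
    for f g f' g'
  proof -
    have "ennreal (mdist Y (f (g y)) (f' (g' y))) \<le> (SUP y\<in>mspace Y. ennreal (mdist Y (f y) (f' y)))
       + (SUP y\<in>mspace Y. ennreal (mdist Y (g y) (g' y)))" if y: "y \<in> mspace Y" for y
    proof -
      have m: "g y \<in> mspace Y" "g' y \<in> mspace Y" "f (g y) \<in> mspace Y" "f' (g y) \<in> mspace Y" "f' (g' y) \<in> mspace Y"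
        "mdist Y (f' (g y)) (f' (g' y)) = mdist Y (g y) (g' y)"
        using y \<open>f \<in> _\<close> \<open>g \<in> _\<close> \<open>f' \<in> _\<close> \<open>g' \<in> _\<close> by (auto simp: Aut_def isometries_def bij_betw_apply)
      have "mdist Y (f (g y)) (f' (g' y)) \<le> mdist Y (f (g y)) (f' (g y)) + mdist Y (g y) (g' y)"
        using mdist_triangle[OF m(3,4,5)] m(6) by simp
      then have "ennreal (mdist Y (f (g y)) (f' (g' y))) \<le> ennreal (mdist Y (f (g y)) (f' (g y))) + ennreal (mdist Y (g y) (g' y))"
        by (simp flip: ennreal_plus)
      also have "\<dots> \<le> (SUP y\<in>mspace Y. ennreal (mdist Y (f y) (f' y)))
       + (SUP y\<in>mspace Y. ennreal (mdist Y (g y) (g' y)))"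
        using m by (intro add_mono SUP_upper2[of "g y" "mspace Y"] SUP_upper2[of y "mspace Y"] y) auto
      finally show ?thesis .
    qed
    then show ?thesis by (auto simp: Aut_def compose_def intro!: SUP_least)
  qed
  ultimately show ?thesis
    unfolding extended_metric_group_def extended_metric_group_axioms_def
    by (auto simp: Aut_def mdist_commute)
qed


section \<open>The metric fundamental group is a metric group\<close>

lemma loops_n_append_nth:
  assumes "u \<in> loops_n X x n"
  shows "i \<le> n + 1 \<Longrightarrow> (u @ tl p) ! i = u ! i"
    and "p \<in> loops_n X x m \<Longrightarrow> i \<le> m + 1 \<Longrightarrow> (u @ tl p) ! (n + 1 + i) = p ! i"
proof -
  show "i \<le> n + 1 \<Longrightarrow> (u @ tl p) ! i = u ! i"
    using assms by (simp add: loops_n_def nth_append)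
  assume p: "p \<in> loops_n X x m" and i: "i \<le> m + 1"
  have u: "length u = n + 2" "u ! (n + 1) = x" "p ! 0 = x" "length p = m + 2"
    using assms p by (simp_all add: loops_n_def)
  show "(u @ tl p) ! (n + 1 + i) = p ! i"
  proof (cases i)
    case 0
    then show ?thesis using u by (simp add: nth_append)
  next
    case (Suc k)
    then have "n + 1 + i = length u + k" using u by simp
    then have "(u @ tl p) ! (n + 1 + i) = tl p ! k" by (simp only: nth_append_length_plus)
    then show ?thesis using u i Suc by (simp add: nth_tl)
  qed
qed

lemma loops_n_append:
  assumes u: "u \<in> loops_n X x n" and p: "p \<in> loops_n X x m"
  shows "u @ tl p \<in> loops_n X x (n + m + 1)"
proof -
  have "(u @ tl p) ! (n + m + 2) = x"
    using loops_n_append_nth(2)[OF u p, of "m + 1"] p by (simp add: loops_n_def)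
  moreover have "set (tl p) \<subseteq> mspace X"
    using p by (cases p) (auto simp: loops_n_def)
  moreover have "(u @ tl p) ! 0 = x"
    using loops_n_append_nth(1)[OF u, of 0 p] u by (simp add: loops_n_def)
  ultimately show ?thesis
    using u p by (simp add: loops_n_def)
qed

lemma loopsI: "u \<in> loops_n X x n \<Longrightarrow> u \<in> loops X x"
  by (simp add: loops_def exI)

lemma loopsE:
  assumes "u \<in> loops X x"
  obtains n where "u \<in> loops_n X x n"
  using assms unfolding loops_def by (elim UN_E)

lemma loops_append: "u \<in> loops X x \<Longrightarrow> p \<in> loops X x \<Longrightarrow> u @ tl p \<in> loops X x"
  by (elim loopsE) (rule loopsI[OF loops_n_append])

lemma loop_edge_loops: "loop_edge X x u v w \<Longrightarrow> u \<in> loops X x \<and> v \<in> loops X x"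
  unfolding loop_edge_def by (elim exE conjE) (intro conjI loopsI)

lemma loop_edge_append_left:
  assumes e: "loop_edge X x u v w" and p: "p \<in> loops X x"
  shows "loop_edge X x (u @ tl p) (v @ tl p) w"
proof -
  obtain m where p: "p \<in> loops_n X x m" using p by (auto simp: loops_def)
  from e obtain n j where u: "u \<in> loops_n X x n" and v: "v \<in> loops_n X x (n + 1)" and j: "j \<le> n"
    and a: "\<forall>i. 1 \<le> i \<and> i \<le> j \<longrightarrow> u ! i = v ! i"
    and b: "\<forall>i. j + 1 \<le> i \<and> i \<le> n \<longrightarrow> u ! i = v ! (i + 1)"
    and w: "w = (if v ! j \<noteq> v ! (j + 2)
             then mdist X (v ! j) (v ! (j + 1)) + mdist X (v ! (j + 1)) (v ! (j + 2))
                  - mdist X (v ! j) (v ! (j + 2)) else 0)"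
    unfolding loop_edge_def by blast
  note U = loops_n_append_nth[OF u] and V = loops_n_append_nth[OF v]
  have "(u @ tl p) ! i = (v @ tl p) ! (i + 1)" if "j + 1 \<le> i" "i \<le> n + m + 1" for i
  proof (cases "i \<le> n")
    case True
    then show ?thesis using U(1)[of i p] V(1)[of "i+1" p] b that by simp
  next
    case False
    then obtain k where k: "i = n + 1 + k" by (metis add.commute le_add_diff_inverse not_less_eq_eq Suc_eq_plus1)
    then show ?thesis using U(2)[OF p, of k] V(2)[OF p, of k] that by (simp add: algebra_simps)
  qed
  then show ?thesis
    unfolding loop_edge_def
    using j a w loops_n_append[OF u p] loops_n_append[OF v p] U(1)[of _ p] V(1)[of _ p]
    by (intro exI[of _ "n + m + 1"] exI[of _ j]) (auto simp: algebra_simps)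
qed

lemma loop_edge_append_right:
  assumes e: "loop_edge X x u v w" and p: "p \<in> loops X x"
  shows "loop_edge X x (p @ tl u) (p @ tl v) w"
proof -
  obtain m where p: "p \<in> loops_n X x m" using p by (auto simp: loops_def)
  from e obtain n j where u: "u \<in> loops_n X x n" and v: "v \<in> loops_n X x (n + 1)" and j: "j \<le> n"
    and a: "\<forall>i. 1 \<le> i \<and> i \<le> j \<longrightarrow> u ! i = v ! i"
    and b: "\<forall>i. j + 1 \<le> i \<and> i \<le> n \<longrightarrow> u ! i = v ! (i + 1)"
    and w: "w = (if v ! j \<noteq> v ! (j + 2)
             then mdist X (v ! j) (v ! (j + 1)) + mdist X (v ! (j + 1)) (v ! (j + 2))
                  - mdist X (v ! j) (v ! (j + 2)) else 0)"
    unfolding loop_edge_def by blast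
  note P1 = loops_n_append_nth(1)[OF p] and U = loops_n_append_nth(2)[OF p u]
    and V = loops_n_append_nth(2)[OF p v]
  have 1: "(p @ tl u) ! i = (p @ tl v) ! i" if "i \<le> m + 1 + j" for i
  proof (cases "i \<le> m + 1")
    case True then show ?thesis using P1 by simp
  next
    case False
    then obtain k where k: "i = m + 1 + k" "k \<ge> 1" by (metis Suc_eq_plus1 add.commute le_add_diff_inverse less_eq_Suc_le less_imp_le_nat not_le_imp_less add_le_cancel_left)
    then show ?thesis using U[of k] V[of k] that a j by simp
  qed
  have 2: "(p @ tl u) ! i = (p @ tl v) ! (i + 1)" if i: "m + 1 + j + 1 \<le> i" "i \<le> m + n + 1" for i
  proof -
    obtain k where k: "i = m + 1 + k" using i by (metis add.assoc le_iff_add)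
    then show ?thesis using U[of k] V[of "k + 1"] i b by (simp add: algebra_simps)
  qed
  show ?thesis
    unfolding loop_edge_def
    using j w 1 2 loops_n_append[OF p u] loops_n_append[OF p v] V[of j] V[of "j+1"] V[of "j+2"]
    by (intro exI[of _ "m + n + 1"] exI[of _ "m + 1 + j"]) (auto simp: algebra_simps)
qed

lemma loop_edge_nonneg: "loop_edge X x u v w \<Longrightarrow> 0 \<le> w"
proof -
  assume "loop_edge X x u v w"
  then obtain n j where "v \<in> loops_n X x (n + 1)" "j \<le> n"
    and w: "w = (if v ! j \<noteq> v ! (j + 2)
             then mdist X (v ! j) (v ! (j + 1)) + mdist X (v ! (j + 1)) (v ! (j + 2))
                  - mdist X (v ! j) (v ! (j + 2)) else 0)"
    unfolding loop_edge_def by blast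
  then have "v ! i \<in> mspace X" if "i \<le> j + 2" for i
    using that nth_mem[of i v] by (auto simp: loops_n_def)
  then have "v ! j \<in> mspace X" "v ! (j+1) \<in> mspace X" "v ! (j+2) \<in> mspace X"
    by simp_all
  from mdist_triangle[OF this] show ?thesis unfolding w by simp
qed

lemma loop_path_nonneg: "loop_path X x u s v \<Longrightarrow> 0 \<le> s"
proof (induction rule: loop_path.induct)
  case (step u s v v' w)
  then have "0 \<le> w" using loop_edge_nonneg by metis
  then show ?case using step by simp
qed simp

lemma loop_path_loops: "loop_path X x u s v \<Longrightarrow> u \<in> loops X x \<and> v \<in> loops X x"
proof (induction rule: loop_path.induct)
  case (step u s v v' w)
  then have "v' \<in> loops X x" using loop_edge_loops by metis
  then show ?case using step by simp
qed simp

lemma loop_path_trans: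
  assumes "loop_path X x v t p" "loop_path X x u s v"
  shows "loop_path X x u (s + t) p"
  using assms
proof (induction rule: loop_path.induct)
  case (step v t p p' w)
  show ?case
    using loop_path.step[OF step.IH[OF step.prems] step.hyps(2)] by (simp add: add.assoc)
qed simp

lemma loop_path_edge:
  assumes "loop_edge X x u v w"
  shows "loop_path X x u w v" "loop_path X x v w u"
proof -
  have l: "u \<in> loops X x" "v \<in> loops X x" using loop_edge_loops[OF assms] by simp_all
  show "loop_path X x u w v"
    using loop_path.step[OF loop_path.refl[OF l(1)] disjI1[OF assms]] by simp
  show "loop_path X x v w u"
    using loop_path.step[OF loop_path.refl[OF l(2)] disjI2[OF assms]] by simp
qed

lemma loop_path_sym: "loop_path X x u s v \<Longrightarrow> loop_path X x v s u"
proof (induction rule: loop_path.induct)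
  case (step u s v v' w)
  then have "loop_path X x v' w v" using loop_path_edge by metis
  then show ?case using loop_path_trans[OF step.IH \<open>loop_path X x v' w v\<close>] by (simp add: add.commute)
qed (rule loop_path.refl)

lemma loop_path_append_left:
  "loop_path X x u s v \<Longrightarrow> p \<in> loops X x \<Longrightarrow> loop_path X x (u @ tl p) s (v @ tl p)"
proof (induction rule: loop_path.induct)
  case (refl u)
  then show ?case by (intro loop_path.refl loops_append)
next
  case (step u s v v' w)
  then show ?case
    using loop_path.step[OF step.IH[OF step.prems]] loop_edge_append_left[OF _ step.prems] by metis
qed

lemma loop_path_append_right:
  "loop_path X x u s v \<Longrightarrow> p \<in> loops X x \<Longrightarrow> loop_path X x (p @ tl u) s (p @ tl v)"
proof (induction rule: loop_path.induct)
  case (refl u)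
  then show ?case by (intro loop_path.refl loops_append)
next
  case (step u s v v' w)
  then show ?case
    using loop_path.step[OF step.IH[OF step.prems]] loop_edge_append_right[OF _ step.prems] by metis
qed

lemma loop_edge_delete:
  assumes "p @ [a, b, c] @ q \<in> loops X x"
  shows "loop_edge X x (p @ [a, c] @ q) (p @ [a, b, c] @ q)
    (if a \<noteq> c then mdist X a b + mdist X b c - mdist X a c else 0)"
proof -
  let ?v = "p @ [a, b, c] @ q" and ?u = "p @ [a, c] @ q"
  obtain n where v: "?v \<in> loops_n X x n" using assms by (rule loopsE)
  define k where "k = length p + length q"
  have n: "n = k + 1" using v by (simp add: loops_n_def k_def)
  have l: "?v ! 0 = x" "?v ! (k + 2) = x" using v n by (simp_all add: loops_n_def)
  have "?u ! 0 = x" using l(1) by (cases p) simp_all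
  moreover have "?u ! (k + 1) = x"
  proof -
    have "?u ! (k + 1) = last ?u" by (subst last_conv_nth) (simp_all add: k_def)
    also have "\<dots> = last ?v" by simp
    also have "\<dots> = ?v ! (k + 2)" by (subst last_conv_nth) (simp_all add: k_def)
    finally show ?thesis using l by simp
  qed
  moreover have "set ?u \<subseteq> mspace X" using v by (simp add: loops_n_def)
  ultimately have u: "?u \<in> loops_n X x k" unfolding loops_n_def by (simp add: k_def)
  have v_nth: "?v ! (length p + d) = ([a, b, c] @ q) ! d" for d
    by (rule nth_append_length_plus)
  have 1: "?u ! i = ?v ! i" if "i \<le> length p" for i
    using that by (auto simp: nth_append)
  have 2: "?u ! i = ?v ! (i + 1)" if "length p + 1 \<le> i" for i
  proof -
    define d where "d = i - length p - 1"
    have d: "i = length p + (1 + d)" using that by (simp add: d_def)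
    then have "?u ! i = ([a, c] @ q) ! (1 + d)" by (simp only: nth_append_length_plus)
    also have "\<dots> = ([a, b, c] @ q) ! (2 + d)" by simp
    also have "\<dots> = ?v ! (i + 1)" using v_nth[of "2 + d"] d by simp
    finally show ?thesis .
  qed
  have 3: "?v ! length p = a" "?v ! (length p + 1) = b" "?v ! (length p + 2) = c"
    using v_nth[of 0] v_nth[of 1] v_nth[of 2] by simp_all
  have "\<forall>i. 1 \<le> i \<and> i \<le> length p \<longrightarrow> ?u ! i = ?v ! i" using 1 by blast
  moreover have "\<forall>i. length p + 1 \<le> i \<and> i \<le> k \<longrightarrow> ?u ! i = ?v ! (i + 1)" using 2 by blast
  moreover have "length p \<le> k" by (simp add: k_def)
  ultimately show ?thesis
    unfolding loop_edge_def using u v[unfolded n]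
    by (intro exI[of _ k] exI[of _ "length p"] conjI) (simp_all only: 3)
qed

lemma loop_path_delete_all:
  assumes "u \<in> loops_n X x n"
  shows "\<exists>s. loop_path X x u s [x, x]"
  using assms
proof (induction n arbitrary: u)
  case 0
  then have "u = [x, x]" by (auto simp: loops_n_def length_Suc_conv)
  then show ?case using loop_path.refl[OF loopsI[OF 0]] by blast
next
  case (Suc n)
  then obtain a b c q where u: "u = [] @ [a, b, c] @ q"
    by (auto simp: loops_n_def length_Suc_conv)
  with Suc.prems have "[] @ [a, b, c] @ q \<in> loops X x" by (metis loopsI)
  from loop_edge_delete[OF this] obtain w where e: "loop_edge X x ([] @ [a, c] @ q) u w" 
    unfolding u by blast
  then have "[] @ [a, c] @ q \<in> loops_n X x n"
    using Suc.prems u by (auto simp: loop_edge_def loops_n_def)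
  from Suc.IH[OF this] show ?case using loop_path_trans[OF _ loop_path_edge(2)[OF e]] by metis
qed

lemma loop_path_exists:
  "u \<in> loops X x \<Longrightarrow> v \<in> loops X x \<Longrightarrow> \<exists>s. loop_path X x u s v"
  using loop_path_delete_all loop_path_trans loop_path_sym by (metis loopsE)

lemma loop_dist_le: "loop_path X x u s v \<Longrightarrow> loop_dist X x u v \<le> ennreal s"
  unfolding loop_dist_def by (rule Inf_lower) blast

lemma loop_dist_finite: "u \<in> loops X x \<Longrightarrow> v \<in> loops X x \<Longrightarrow> loop_dist X x u v < \<infinity>"
  using loop_path_exists loop_dist_le by (metis ennreal_less_top infinity_ennreal_def order_le_less_trans)

lemma loop_dist_commute: "loop_dist X x u v = loop_dist X x v u"
  unfolding loop_dist_def by (metis loop_path_sym)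

lemma loop_dist_zero: "loop_path X x u 0 v \<Longrightarrow> loop_dist X x u v = 0"
  using loop_dist_le by fastforce

lemma loop_dist_approx:
  assumes "u \<in> loops X x" "v \<in> loops X x" "0 < (e::real)"
  shows "\<exists>s. loop_path X x u s v \<and> ennreal s \<le> loop_dist X x u v + ennreal e"
proof -
  have "loop_dist X x u v < loop_dist X x u v + ennreal e"
    using loop_dist_finite[OF assms(1,2)] assms(3)
    by (cases "loop_dist X x u v") (auto simp: ennreal_lessI simp flip: ennreal_plus)
  then show ?thesis
    unfolding loop_dist_def[of X x u v] by (auto simp: Inf_less_iff less_imp_le)
qed

lemma loop_dist_concat:
  assumes "u \<in> loops X x" "v \<in> loops X x" "u' \<in> loops X x" "v' \<in> loops X x"
    and "\<And>s t. loop_path X x u s v \<Longrightarrow> loop_path X x u' t v' \<Longrightarrow> loop_path X x p (s + t) q"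
  shows "loop_dist X x p q \<le> loop_dist X x u v + loop_dist X x u' v'"
proof (rule ennreal_le_epsilon)
  fix e :: real assume "0 < e"
  obtain s where s: "loop_path X x u s v" "ennreal s \<le> loop_dist X x u v + ennreal (e/2)"
    using loop_dist_approx[OF assms(1,2), of "e/2"] \<open>0 < e\<close> by auto
  obtain t where t: "loop_path X x u' t v'" "ennreal t \<le> loop_dist X x u' v' + ennreal (e/2)"
    using loop_dist_approx[OF assms(3,4), of "e/2"] \<open>0 < e\<close> by auto
  have "loop_dist X x p q \<le> ennreal (s + t)" by (intro loop_dist_le assms s t)
  also have "\<dots> = ennreal s + ennreal t" 
    using loop_path_nonneg[OF s(1)] loop_path_nonneg[OF t(1)] by (rule ennreal_plus)
  also have "\<dots> \<le> (loop_dist X x u v + ennreal (e/2)) + (loop_dist X x u' v' + ennreal (e/2))"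
    by (intro add_mono s t)
  also have "\<dots> = loop_dist X x u v + loop_dist X x u' v' + (ennreal (e/2) + ennreal (e/2))"
    by (simp add: ac_simps)
  also have "ennreal (e/2) + ennreal (e/2) = ennreal e"
    using \<open>0 < e\<close> by (simp flip: ennreal_plus)
  finally show "loop_dist X x p q \<le> loop_dist X x u v + loop_dist X x u' v' + ennreal e" .
qed

lemma loop_dist_triangle:
  assumes "u \<in> loops X x" "v \<in> loops X x" "p \<in> loops X x"
  shows "loop_dist X x u p \<le> loop_dist X x u v + loop_dist X x v p"
  by (rule loop_dist_concat[OF assms(1,2,2,3)]) (rule loop_path_trans)

lemma loop_dist_append:
  assumes "u \<in> loops X x" "v \<in> loops X x" "u' \<in> loops X x" "v' \<in> loops X x"
  shows "loop_dist X x (u @ tl v) (u' @ tl v') \<le> loop_dist X x u u' + loop_dist X x v v'"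
proof (rule loop_dist_concat[OF assms(1,3,2,4)])
  fix s t assume s: "loop_path X x u s u'" and t: "loop_path X x v t v'"
  show "loop_path X x (u @ tl v) (s + t) (u' @ tl v')"
    using loop_path_trans[OF loop_path_append_right[OF t assms(3)] loop_path_append_left[OF s assms(2)]] .
qed

lemma equiv_loop_rel: "equiv (loops X x) (loop_rel X x)"
proof (rule equivI)
  show "refl_on (loops X x) (loop_rel X x)"
    by (auto simp: refl_on_def loop_rel_def intro: loop_dist_zero loop_path.refl)
  show "sym (loop_rel X x)" by (auto simp: sym_def loop_rel_def loop_dist_commute)
  show "trans (loop_rel X x)"
  proof (rule transI)
    fix u v p assume "(u, v) \<in> loop_rel X x" "(v, p) \<in> loop_rel X x"
    then show "(u, p) \<in> loop_rel X x"
      using loop_dist_triangle[of u X x v p] by (simp add: loop_rel_def)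
  qed
qed (auto simp: loop_rel_def)

lemma pi1m_mult_class:
  assumes "u \<in> loops X x" "v \<in> loops X x"
  shows "loop_rel X x `` {u} \<otimes>\<^bsub>pi1m X x\<^esub> loop_rel X x `` {v} = loop_rel X x `` {u @ tl v}"
proof -
  have "congruent2 (loop_rel X x) (loop_rel X x) (\<lambda>u v. loop_rel X x `` {u @ tl v})"
  proof (rule congruent2I')
    fix u u' v v' assume "(u, u') \<in> loop_rel X x" "(v, v') \<in> loop_rel X x"
    then have "(u @ tl v, u' @ tl v') \<in> loop_rel X x"
      using loop_dist_append[of u X x v u' v'] by (auto simp: loop_rel_def loops_append)
    then show "loop_rel X x `` {u @ tl v} = loop_rel X x `` {u' @ tl v'}"
      by (rule equiv_class_eq[OF equiv_loop_rel])
  qed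
  then show ?thesis
    by (simp add: pi1m_def UN_equiv_class2[OF equiv_loop_rel equiv_loop_rel _ assms])
qed

lemma pi1m_edist_class:
  assumes "u \<in> loops X x" "v \<in> loops X x"
  shows "edist (pi1m X x) (loop_rel X x `` {u}) (loop_rel X x `` {v}) = loop_dist X x u v"
proof -
  have "congruent2 (loop_rel X x) (loop_rel X x) (\<lambda>u v. {loop_dist X x u v})"
  proof (rule congruent2I')
    have *: "loop_dist X x u v \<le> loop_dist X x u' v'"
      if "(u, u') \<in> loop_rel X x" "(v, v') \<in> loop_rel X x" for u u' v v'
      using loop_dist_triangle[of u X x u' v] loop_dist_triangle[of u' X x v' v] that
      by (auto simp: loop_rel_def loop_dist_commute)
    fix u u' v v' assume "(u, u') \<in> loop_rel X x" "(v, v') \<in> loop_rel X x"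
    then show "{loop_dist X x u v} = {loop_dist X x u' v'}"
      using * equiv_loop_rel[of X x] by (metis antisym equivE symE)
  qed
  then show ?thesis
    by (simp add: pi1m_def UN_equiv_class2[OF equiv_loop_rel equiv_loop_rel _ assms])
qed

lemma mdist_self: "a \<in> mspace X \<Longrightarrow> mdist X a a = 0"
  by simp

lemma const_loop: "x \<in> mspace X \<Longrightarrow> [x, x] \<in> loops X x"
  by (rule loopsI[of _ _ _ 0]) (simp add: loops_n_def)

lemma rev_loop: "u \<in> loops X x \<Longrightarrow> rev u \<in> loops X x"
proof (elim loopsE)
  fix n assume "u \<in> loops_n X x n"
  then have "rev u \<in> loops_n X x n" by (simp add: loops_n_def rev_nth)
  then show ?thesis by (rule loopsI)
qed

lemma loop_path_palindrome:
  "set p \<subseteq> mspace X \<Longrightarrow> p \<noteq> [] \<Longrightarrow> hd p = x \<Longrightarrow> loop_path X x (p @ rev p) 0 [x, x]"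
proof (induction p rule: rev_induct)
  case (snoc a p)
  show ?case
  proof (cases p rule: rev_cases)
    case Nil
    then show ?thesis using snoc.prems loop_path.refl[OF const_loop[of x X]] by simp
  next
    case (snoc p' c)
    have "p @ [a, a] @ rev p \<in> loops X x"
    proof (rule loopsI)
      let ?u = "p @ [a, a] @ rev p"
      have "?u ! 0 = x" using snoc snoc.prems by (cases p') simp_all
      moreover have "last ?u = x" using snoc snoc.prems by (cases p') (simp_all add: last_rev)
      then have "?u ! (2 * length p + 1) = x" by (subst (asm) last_conv_nth) (simp_all add: mult_2)
      ultimately show "?u \<in> loops_n X x (2 * length p)"
        using snoc.prems by (simp add: loops_n_def)
    qed
    then have "p' @ [c, a, a] @ (c # rev p') \<in> loops X x" using snoc by simp
    from loop_edge_delete[OF this]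
    have e: "loop_edge X x (p' @ [c, a, c] @ rev p') (p @ [a, a] @ rev p) 0"
      using snoc snoc.prems by (auto simp: mdist_self split: if_splits)
    then have "loop_edge X x (p' @ [c, c] @ rev p') (p' @ [c, a, c] @ rev p') 0"
      using loop_edge_delete[of p' c a c "rev p'" X x] loop_edge_loops by fastforce
    from loop_path_trans[OF loop_path_edge(2)[OF this] loop_path_edge(2)[OF e]]
    have "loop_path X x (p @ [a, a] @ rev p) 0 (p @ rev p)" using snoc by simp
    moreover have "hd p = x" using snoc snoc.prems by (cases p') simp_all
    then have "loop_path X x (p @ rev p) 0 [x, x]"
      using snoc.IH snoc.prems snoc by simp
    ultimately show ?thesis using loop_path_trans by fastforce
  qed
qed simp

lemma loop_path_inverse:
  assumes "u \<in> loops X x"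
  shows "loop_path X x (u @ tl (rev u)) 0 [x, x]"
proof -
  obtain n where u: "u \<in> loops_n X x n" using assms by (rule loopsE)
  obtain p y c where ue: "u = p @ [y, c]"
    using u by (cases u rule: rev_cases; cases "butlast u" rule: rev_cases) (auto simp: loops_n_def)
  have m: "set u \<subseteq> mspace X" "u \<noteq> []" "hd u = x"
    using u by (cases u; simp add: loops_n_def)+
  have "u @ rev u \<in> loops X x" using loop_path_loops[OF loop_path_palindrome[OF m]] by simp
  then have l: "p @ [y, c, c] @ (y # rev p) \<in> loops X x" using ue by simp
  have "loop_edge X x (u @ tl (rev u)) (u @ rev u) 0"
    using loop_edge_delete[OF l] m ue by (auto simp: mdist_self split: if_splits)
  then show ?thesis
    using loop_path_trans[OF loop_path_palindrome[OF m] loop_path_edge(1)] by simp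
qed

lemma pi1m_carrier_cases:
  assumes "A \<in> carrier (pi1m X x)"
  obtains u where "u \<in> loops X x" "A = loop_rel X x `` {u}"
  using assms by (simp add: pi1m_def) (erule quotientE)

lemma pi1m_class_eq:
  assumes "loop_path X x u 0 v"
  shows "loop_rel X x `` {u} = loop_rel X x `` {v}"
  using loop_path_loops[OF assms] loop_dist_zero[OF assms]
  by (intro equiv_class_eq[OF equiv_loop_rel]) (auto simp: loop_rel_def)

lemma metric_group_pi1m:
  assumes x: "x \<in> mspace X"
  shows "metric_group (pi1m X x)"
proof -
  let ?G = "pi1m X x"
  have one: "\<one>\<^bsub>?G\<^esub> = loop_rel X x `` {[x, x]}" by (simp add: pi1m_def)
  have cl: "u \<in> loops X x \<Longrightarrow> loop_rel X x `` {u} \<in> carrier ?G" for u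
    by (simp add: pi1m_def quotientI)
  have "group ?G"
  proof (rule groupI)
    fix A B assume "A \<in> carrier ?G" "B \<in> carrier ?G"
    then show "A \<otimes>\<^bsub>?G\<^esub> B \<in> carrier ?G"
      by (elim pi1m_carrier_cases) (simp add: pi1m_mult_class cl loops_append)
  next
    show "\<one>\<^bsub>?G\<^esub> \<in> carrier ?G" unfolding one by (intro cl const_loop x)
  next
    fix A B C assume "A \<in> carrier ?G" "B \<in> carrier ?G" "C \<in> carrier ?G"
    then obtain u v w where *: "u \<in> loops X x" "v \<in> loops X x" "w \<in> loops X x"
      "A = loop_rel X x `` {u}" "B = loop_rel X x `` {v}" "C = loop_rel X x `` {w}"
      by (elim pi1m_carrier_cases)
    then have "v \<noteq> []" by (auto elim!: loopsE simp: loops_n_def)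
    then show "A \<otimes>\<^bsub>?G\<^esub> B \<otimes>\<^bsub>?G\<^esub> C = A \<otimes>\<^bsub>?G\<^esub> (B \<otimes>\<^bsub>?G\<^esub> C)"
      using * by (simp add: pi1m_mult_class loops_append)
  next
    fix A assume "A \<in> carrier ?G"
    then obtain u where u: "u \<in> loops X x" "A = loop_rel X x `` {u}" by (elim pi1m_carrier_cases)
    then obtain c q where ue: "u = x # c # q"
      by (cases u; cases "tl u") (auto elim!: loopsE simp: loops_n_def)
    have l: "[] @ [x, x, c] @ q \<in> loops X x" using loops_append[OF const_loop[OF x] u(1)] ue by simp
    have "loop_edge X x u ([x, x] @ tl u) 0"
      using loop_edge_delete[OF l] ue x by (auto simp: mdist_self split: if_splits)
    then have "loop_path X x ([x, x] @ tl u) 0 u" by (rule loop_path_edge)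
    then show "\<one>\<^bsub>?G\<^esub> \<otimes>\<^bsub>?G\<^esub> A = A"
      using pi1m_class_eq u pi1m_mult_class[OF const_loop[OF x] u(1)] one by simp
    have "loop_path X x (rev u @ tl u) 0 [x, x]" using loop_path_inverse[OF rev_loop[OF u(1)]] by simp
    then have "loop_rel X x `` {rev u} \<otimes>\<^bsub>?G\<^esub> A = \<one>\<^bsub>?G\<^esub>"
      using pi1m_class_eq u pi1m_mult_class[OF rev_loop[OF u(1)] u(1)] one by simp
    then show "\<exists>B\<in>carrier ?G. B \<otimes>\<^bsub>?G\<^esub> A = \<one>\<^bsub>?G\<^esub>"
      by (rule bexI[OF _ cl[OF rev_loop[OF u(1)]]])
  qed
  moreover have "edist ?G A B = 0 \<longleftrightarrow> A = B" if "A \<in> carrier ?G" "B \<in> carrier ?G" for A B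
  proof -
    obtain u v where *: "u \<in> loops X x" "v \<in> loops X x"
      "A = loop_rel X x `` {u}" "B = loop_rel X x `` {v}"
      using \<open>A \<in> _\<close> \<open>B \<in> _\<close> by (elim pi1m_carrier_cases)
    then have "A = B \<longleftrightarrow> (u, v) \<in> loop_rel X x"
      using eq_equiv_class_iff[OF equiv_loop_rel] by metis
    moreover have "(u, v) \<in> loop_rel X x \<longleftrightarrow> loop_dist X x u v = 0"
      using *(1,2) by (simp add: loop_rel_def)
    moreover have "edist ?G A B = loop_dist X x u v" using * by (simp only: pi1m_edist_class)
    ultimately show ?thesis by simp
  qed
  moreover have "edist ?G A B = edist ?G B A" if "A \<in> carrier ?G" "B \<in> carrier ?G" for A B
    using that by (elim pi1m_carrier_cases) (simp add: pi1m_edist_class loop_dist_commute)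
  moreover have "edist ?G A C \<le> edist ?G A B + edist ?G B C"
    if "A \<in> carrier ?G" "B \<in> carrier ?G" "C \<in> carrier ?G" for A B C
    using that by (elim pi1m_carrier_cases) (simp add: pi1m_edist_class loop_dist_triangle)
  moreover have "edist ?G (A \<otimes>\<^bsub>?G\<^esub> B) (A' \<otimes>\<^bsub>?G\<^esub> B') \<le> edist ?G A A' + edist ?G B B'"
    if "A \<in> carrier ?G" "B \<in> carrier ?G" "A' \<in> carrier ?G" "B' \<in> carrier ?G" for A B A' B'
    using that by (elim pi1m_carrier_cases) (simp add: pi1m_edist_class pi1m_mult_class loops_append loop_dist_append)
  moreover have "edist ?G A B < \<infinity>" if "A \<in> carrier ?G" "B \<in> carrier ?G" for A B
    using that by (elim pi1m_carrier_cases) (use loop_dist_finite in \<open>simp add: pi1m_edist_class\<close>)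
  ultimately show ?thesis
    by (intro metric_group.intro extended_metric_group.intro extended_metric_group_axioms.intro
        metric_group_axioms.intro)
qed

end

theory Submission
  imports Defs
begin

text \<open>
  A metric fibration has a parallel transport: a point \<open>\<epsilon>\<close> over \<open>x\<close> has a nearest point
  over \<open>x'\<close>, and by symmetry of the metric these nearest point maps between two fibers are mutually
  inverse isometries. Transporting along \<open>x, x', x''\<close> differs from transporting along \<open>x, x''\<close> by at
  most the defect of the triangle inequality. After the fibers are identified with \<open>Y\<close>, the transport
  is therefore an action of \<open>Aut Y\<close>, and the distance in the total space is
  \<open>d (x, y) (x', y') = d x x' + d (F x x' y) y'\<close> (lemma \<open>exists_chart\<close>). Conversely this
  formula makes \<open>X \<times> Y\<close> a fibration for any action \<open>F\<close> (lemmas \<open>exists_total_space\<close> and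
  \<open>chart_in_Fib\<close>). In these coordinates an isomorphism over \<open>X\<close> is a family of isometries of \<open>Y\<close>
  that commutes with transport, that is, a transformation of actions (lemma
  \<open>bij_betw_chart_map\<close>). Hence the total space is a fully faithful and essentially surjective
  functor from actions to the core of fibrations.

  For the second claim \<open>Aut Y\<close> may be any extended metric group \<open>G\<close>. A homomorphism \<open>\<phi>\<close> from the
  fundamental group gives the action whose value \<open>F x x'\<close> is \<open>\<phi> [x\<^sub>0, x', x, x\<^sub>0]\<close>. Conversely
  the holonomy of an action along a loop is a product of values of \<open>F\<close>; deleting a letter from
  the loop changes it by at most the weight of the edge, so holonomy is a Lipschitz homomorphism. The
  triangular loops generate the fundamental group, and therefore conjugations of homomorphisms are
  the same as transformations of the actions (lemma \<open>equivalence_functor_loop_action\<close>).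
  Composing both functors gives the equivalence between homomorphisms and fibrations.
\<close>

section \<open>Fully faithful and essentially surjective functors\<close>

lemma category_id: "is_category C \<Longrightarrow> a \<in> cat_obj C \<Longrightarrow> cat_id C a \<in> cat_hom C a a"
  by (simp add: is_category_def)

lemma category_comp:
  "\<lbrakk>is_category C; a \<in> cat_obj C; b \<in> cat_obj C; c \<in> cat_obj C; f \<in> cat_hom C a b; g \<in> cat_hom C b c\<rbrakk>
    \<Longrightarrow> cat_comp C a b c g f \<in> cat_hom C a c"
  by (simp add: is_category_def)

lemma category_id_right:
  "\<lbrakk>is_category C; a \<in> cat_obj C; b \<in> cat_obj C; f \<in> cat_hom C a b\<rbrakk>
    \<Longrightarrow> cat_comp C a a b f (cat_id C a) = f"
  by (simp add: is_category_def)

lemma category_id_left: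
  "\<lbrakk>is_category C; a \<in> cat_obj C; b \<in> cat_obj C; f \<in> cat_hom C a b\<rbrakk>
    \<Longrightarrow> cat_comp C a b b (cat_id C b) f = f"
  by (simp add: is_category_def)

lemma category_assoc:
  "\<lbrakk>is_category C; a \<in> cat_obj C; b \<in> cat_obj C; c \<in> cat_obj C; d \<in> cat_obj C;
    f \<in> cat_hom C a b; g \<in> cat_hom C b c; h \<in> cat_hom C c d\<rbrakk>
    \<Longrightarrow> cat_comp C a b d (cat_comp C b c d h g) f = cat_comp C a c d h (cat_comp C a b c g f)"
  unfolding is_category_def by metis

lemmas category_rules =
  category_id category_comp category_id_right category_id_left category_assoc

lemma cancel_section:
  assumes "is_category C" "a \<in> cat_obj C" "b \<in> cat_obj C" "c \<in> cat_obj C"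
    and "f \<in> cat_hom C b c" "g \<in> cat_hom C c b" "cat_comp C b c b g f = cat_id C b"
    and "h \<in> cat_hom C a b"
  shows "cat_comp C a c b g (cat_comp C a b c f h) = h"
  using assms by (simp add: category_id_left flip: category_assoc)

lemma comp_inverse_cancel:
  assumes "is_category C" "a \<in> cat_obj C" "b \<in> cat_obj C" "c \<in> cat_obj C"
    and "f \<in> cat_hom C a b" "f' \<in> cat_hom C b a" "cat_comp C a b a f' f = cat_id C a"
    and "g \<in> cat_hom C b c" "g' \<in> cat_hom C c b" "cat_comp C b c b g' g = cat_id C b"
  shows "cat_comp C a c a (cat_comp C c b a f' g') (cat_comp C a b c g f) = cat_id C a"
  using assms by (simp add: category_rules cancel_section)

lemma cat_isosE:
  assumes "f \<in> cat_isos C a b"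
  obtains g where "f \<in> cat_hom C a b" "g \<in> cat_hom C b a"
    "cat_comp C a b a g f = cat_id C a" "cat_comp C b a b f g = cat_id C b"
  using assms by (auto simp: cat_isos_def)

lemma cat_isos_comp:
  assumes C: "is_category C" "a \<in> cat_obj C" "b \<in> cat_obj C" "c \<in> cat_obj C"
    and f: "f \<in> cat_isos C a b" and g: "g \<in> cat_isos C b c"
  shows "cat_comp C a b c g f \<in> cat_isos C a c"
proof -
  from f g obtain f' g' where
    "f \<in> cat_hom C a b" "f' \<in> cat_hom C b a"
    "cat_comp C a b a f' f = cat_id C a" "cat_comp C b a b f f' = cat_id C b"
    "g \<in> cat_hom C b c" "g' \<in> cat_hom C c b"
    "cat_comp C b c b g' g = cat_id C b" "cat_comp C c b c g g' = cat_id C c"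
    by (elim cat_isosE)
  with C show ?thesis
    unfolding cat_isos_def
    by (auto simp: category_comp comp_inverse_cancel intro!: bexI[of _ "cat_comp C c b a f' g'"])
qed

lemma is_category_core:
  assumes C: "is_category C"
  shows "is_category (core C)"
proof -
  have "cat_id C a \<in> cat_isos C a a" if "a \<in> cat_obj C" for a
    using that C by (auto simp: cat_isos_def category_rules)
  moreover have "cat_isos C a b \<subseteq> cat_hom C a b" for a b by (auto simp: cat_isos_def)
  ultimately show ?thesis
    using cat_isos_comp[OF C] C unfolding core_def is_category_def
    by (simp add: subset_iff)
qed

lemma cat_isos_core: "cat_isos (core C) a b = cat_isos C a b"
  by (auto simp: cat_isos_def core_def)

lemma is_category_full_subcategory:
  "is_category C \<Longrightarrow> A \<subseteq> cat_obj C \<Longrightarrow> is_category (C\<lparr>cat_obj := A\<rparr>)"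
  unfolding is_category_def subset_iff by simp

lemma functor_preserves_isos:
  assumes F: "is_functor C D F Fm" and ab: "a \<in> cat_obj C" "b \<in> cat_obj C" and f: "f \<in> cat_isos C a b"
  shows "Fm a b f \<in> cat_isos D (F a) (F b)"
proof -
  obtain g where "f \<in> cat_hom C a b" "g \<in> cat_hom C b a"
    "cat_comp C a b a g f = cat_id C a" "cat_comp C b a b f g = cat_id C b"
    using f by (rule cat_isosE)
  with F ab show ?thesis
    unfolding is_functor_def cat_isos_def
    by (smt (verit) mem_Collect_eq)
qed

text \<open>This form of an equivalence mentions no inverse. Functors of this kind can be composed before any
  inverse is chosen.\<close>

definition equivalence_functor ::
  "('o, 'm) cat \<Rightarrow> ('p, 'n) cat \<Rightarrow> ('o \<Rightarrow> 'p) \<Rightarrow> ('o \<Rightarrow> 'o \<Rightarrow> 'm \<Rightarrow> 'n) \<Rightarrow> bool" where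
  "equivalence_functor C D F Fm \<longleftrightarrow>
     is_functor C D F Fm \<and>
     (\<forall>a\<in>cat_obj C. \<forall>b\<in>cat_obj C. bij_betw (Fm a b) (cat_hom C a b) (cat_hom D (F a) (F b))) \<and>
     (\<forall>d\<in>cat_obj D. \<exists>c\<in>cat_obj C. cat_isos D (F c) d \<noteq> {})"

lemma equivalence_functor_comp:
  assumes F: "equivalence_functor C D F Fm" and G: "equivalence_functor D E G Gm"
  shows "equivalence_functor C E (\<lambda>a. G (F a)) (\<lambda>a b f. Gm (F a) (F b) (Fm a b f))"
proof -
  have f: "is_functor C D F Fm" "is_functor D E G Gm"
    using F G by (auto simp: equivalence_functor_def)
  then have o: "a \<in> cat_obj C \<Longrightarrow> F a \<in> cat_obj D" "d \<in> cat_obj D \<Longrightarrow> G d \<in> cat_obj E" for a d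
    by (auto simp: is_functor_def)
  have "is_functor C E (\<lambda>a. G (F a)) (\<lambda>a b f. Gm (F a) (F b) (Fm a b f))"
    using f unfolding is_functor_def by simp
  moreover have "bij_betw (\<lambda>f. Gm (F a) (F b) (Fm a b f)) (cat_hom C a b) (cat_hom E (G (F a)) (G (F b)))"
    if "a \<in> cat_obj C" "b \<in> cat_obj C" for a b
    using bij_betw_trans[of "Fm a b" "cat_hom C a b" "cat_hom D (F a) (F b)" "Gm (F a) (F b)"] F G o that
    unfolding equivalence_functor_def comp_def by blast
  moreover have "\<exists>c\<in>cat_obj C. cat_isos E (G (F c)) e \<noteq> {}" if e: "e \<in> cat_obj E" for e
  proof -
    obtain d i where d: "d \<in> cat_obj D" "i \<in> cat_isos E (G d) e"
      using G e unfolding equivalence_functor_def by blast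
    obtain c j where c: "c \<in> cat_obj C" "j \<in> cat_isos D (F c) d"
      using F d(1) unfolding equivalence_functor_def by blast
    have "cat_comp E (G (F c)) (G d) e i (Gm (F c) d j) \<in> cat_isos E (G (F c)) e"
      using functor_preserves_isos[OF f(2) o(1)[OF c(1)] d(1) c(2)] f d c e o
      by (auto simp: is_functor_def intro!: cat_isos_comp)
    with c(1) show ?thesis by blast
  qed
  ultimately show ?thesis by (auto simp: equivalence_functor_def)
qed

text \<open>An inverse functor sends \<open>d\<close> to a chosen \<open>G d\<close> with an isomorphism \<open>e d\<close> from \<open>F (G d)\<close> to
  \<open>d\<close>, and an arrow to the unique lift of its conjugate by these isomorphisms. Since \<open>F\<close> is
  faithful, every equation in \<open>C\<close> can be checked after applying \<open>F\<close>.\<close>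

lemma equivalence_functor_imp_equivalent_categories:
  assumes E: "equivalence_functor C D F Fm"
  shows "equivalent_categories C D"
proof -
  have F: "is_functor C D F Fm" and C: "is_category C" and D: "is_category D"
    using E by (auto simp: equivalence_functor_def is_functor_def)
  have Fo [simp]: "F a \<in> cat_obj D" if "a \<in> cat_obj C" for a
    using F that by (simp add: is_functor_def)
  have Fh [simp]: "Fm a b f \<in> cat_hom D (F a) (F b)"
    if "a \<in> cat_obj C" "b \<in> cat_obj C" "f \<in> cat_hom C a b" for a b f
    using F that by (simp add: is_functor_def)
  have Fid [simp]: "Fm a a (cat_id C a) = cat_id D (F a)" if "a \<in> cat_obj C" for a
    using F that by (simp add: is_functor_def)
  have Fcomp [simp]: "Fm a c (cat_comp C a b c g f) = cat_comp D (F a) (F b) (F c) (Fm b c g) (Fm a b f)"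
    if "a \<in> cat_obj C" "b \<in> cat_obj C" "c \<in> cat_obj C" "f \<in> cat_hom C a b" "g \<in> cat_hom C b c" for a b c f g
    using F that by (simp add: is_functor_def)
  have bij: "bij_betw (Fm a b) (cat_hom C a b) (cat_hom D (F a) (F b))"
    if "a \<in> cat_obj C" "b \<in> cat_obj C" for a b
    using E that by (simp add: equivalence_functor_def)
  have faithful: "f = g" if "a \<in> cat_obj C" "b \<in> cat_obj C" "f \<in> cat_hom C a b" "g \<in> cat_hom C a b"
    "Fm a b f = Fm a b g" for a b f g
    using bij[OF that(1,2)] that(3-) by (auto simp: bij_betw_def inj_on_def)
  define lift where "lift a b h = inv_into (cat_hom C a b) (Fm a b) h" for a b h
  have lift [simp]: "lift a b h \<in> cat_hom C a b" "Fm a b (lift a b h) = h"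
    if "a \<in> cat_obj C" "b \<in> cat_obj C" "h \<in> cat_hom D (F a) (F b)" for a b h
    using bij[OF that(1,2)] that(3) unfolding lift_def bij_betw_def
    by (auto simp: inv_into_into f_inv_into_f)
  note [simp] = category_rules[OF C] category_rules[OF D]

  have "\<forall>d\<in>cat_obj D. \<exists>c e e'. c \<in> cat_obj C \<and> e \<in> cat_hom D (F c) d \<and> e' \<in> cat_hom D d (F c) \<and>
      cat_comp D (F c) d (F c) e' e = cat_id D (F c) \<and> cat_comp D d (F c) d e e' = cat_id D d"
    using E unfolding equivalence_functor_def cat_isos_def by blast
  then obtain G e e' where G: "\<forall>d\<in>cat_obj D. G d \<in> cat_obj C \<and> e d \<in> cat_hom D (F (G d)) d \<and>
      e' d \<in> cat_hom D d (F (G d)) \<and>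
      cat_comp D (F (G d)) d (F (G d)) (e' d) (e d) = cat_id D (F (G d)) \<and>
      cat_comp D d (F (G d)) d (e d) (e' d) = cat_id D d"
    by metis
  then have [simp]: "G d \<in> cat_obj C" "e d \<in> cat_hom D (F (G d)) d" "e' d \<in> cat_hom D d (F (G d))"
      "cat_comp D (F (G d)) d (F (G d)) (e' d) (e d) = cat_id D (F (G d))"
      "cat_comp D d (F (G d)) d (e d) (e' d) = cat_id D d" if "d \<in> cat_obj D" for d
    using that by auto
  have [simp]: "cat_comp D a (F (G d)) d (e d) (cat_comp D a d (F (G d)) (e' d) h) = h"
    if "a \<in> cat_obj D" "d \<in> cat_obj D" "h \<in> cat_hom D a d" for a d h
    using that by (intro cancel_section[OF D]) simp_all

  \<comment> \<open>The transport of an arrow of \<open>D\<close> along the isomorphisms \<open>e\<close> is natural by construction.\<close>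
  define K where "K d d' f = cat_comp D (F (G d)) d' (F (G d')) (e' d') (cat_comp D (F (G d)) d d' f (e d))"
    for d d' f
  have K [simp]: "K d d' f \<in> cat_hom D (F (G d)) (F (G d'))"
    if "d \<in> cat_obj D" "d' \<in> cat_obj D" "f \<in> cat_hom D d d'" for d d' f
    using that by (simp add: K_def)
  have K_nat: "cat_comp D (F (G d)) (F (G d')) d' (e d') (K d d' f) = cat_comp D (F (G d)) d d' f (e d)"
    if "d \<in> cat_obj D" "d' \<in> cat_obj D" "f \<in> cat_hom D d d'" for d d' f
    using that by (simp add: K_def)
  have K_comp: "cat_comp D (F (G d)) (F (G d')) (F (G d'')) (K d' d'' g) (K d d' f)
      = K d d'' (cat_comp D d d' d'' g f)"
    if "d \<in> cat_obj D" "d' \<in> cat_obj D" "d'' \<in> cat_obj D" "f \<in> cat_hom D d d'" "g \<in> cat_hom D d' d''"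
    for d d' d'' f g
    using that by (simp add: K_def)
  have K_id: "K d d (cat_id D d) = cat_id D (F (G d))" if "d \<in> cat_obj D" for d
    using that by (simp add: K_def)
  define Gm where "Gm d d' f = lift (G d) (G d') (K d d' f)" for d d' f
  have Gm [simp]: "Gm d d' f \<in> cat_hom C (G d) (G d')" "Fm (G d) (G d') (Gm d d' f) = K d d' f"
    if "d \<in> cat_obj D" "d' \<in> cat_obj D" "f \<in> cat_hom D d d'" for d d' f
    using that by (simp_all add: Gm_def)
  have "is_functor D C G Gm"
    unfolding is_functor_def
  proof (intro conjI ballI C D)
    fix d assume d: "d \<in> cat_obj D"
    then show "Gm d d (cat_id D d) = cat_id C (G d)"
      by (intro faithful[of "G d" "G d"]) (simp_all add: K_id)
  next
    fix d d' d'' f g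
    assume "d \<in> cat_obj D" "d' \<in> cat_obj D" "d'' \<in> cat_obj D" "f \<in> cat_hom D d d'" "g \<in> cat_hom D d' d''"
    then show "Gm d d'' (cat_comp D d d' d'' g f) = cat_comp C (G d) (G d') (G d'') (Gm d' d'' g) (Gm d d' f)"
      by (intro faithful[of "G d" "G d''"]) (simp_all add: K_comp)
  qed simp_all
  moreover have "naturally_isomorphic D D (\<lambda>a. F (G a)) (\<lambda>a b f. Fm (G a) (G b) (Gm a b f))
      (\<lambda>a. a) (\<lambda>a b f. f)"
    unfolding naturally_isomorphic_def
  proof (intro exI[of _ e] conjI ballI)
    fix d assume "d \<in> cat_obj D"
    then show "e d \<in> cat_isos D (F (G d)) d" by (auto simp: cat_isos_def intro!: bexI[of _ "e' d"])
  qed (simp add: K_nat)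
  moreover have "naturally_isomorphic C C (\<lambda>a. G (F a)) (\<lambda>a b f. Gm (F a) (F b) (Fm a b f))
      (\<lambda>a. a) (\<lambda>a b f. f)"
    unfolding naturally_isomorphic_def
  proof (intro exI[of _ "\<lambda>a. lift (G (F a)) a (e (F a))"] conjI ballI)
    fix a assume a: "a \<in> cat_obj C"
    let ?i = "lift (G (F a)) a (e (F a))" and ?j = "lift a (G (F a)) (e' (F a))"
    have "cat_comp C (G (F a)) a (G (F a)) ?j ?i = cat_id C (G (F a))"
      using a by (intro faithful[of "G (F a)" "G (F a)"]) simp_all
    moreover have "cat_comp C a (G (F a)) a ?i ?j = cat_id C a"
      using a by (intro faithful[of a a]) simp_all
    ultimately show "?i \<in> cat_isos C (G (F a)) a"
      using a by (auto simp: cat_isos_def intro!: bexI[of _ ?j])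
  next
    fix a b f assume "a \<in> cat_obj C" "b \<in> cat_obj C" "f \<in> cat_hom C a b"
    then show "cat_comp C (G (F a)) (G (F b)) b (lift (G (F b)) b (e (F b))) (Gm (F a) (F b) (Fm a b f)) =
        cat_comp C (G (F a)) a b f (lift (G (F a)) a (e (F a)))"
      by (intro faithful[of "G (F a)" b]) (simp_all add: K_nat)
  qed
  ultimately show ?thesis using F unfolding equivalent_categories_def by blast
qed

lemma equivalent_categories_sym: "equivalent_categories C D \<Longrightarrow> equivalent_categories D C"
  unfolding equivalent_categories_def by blast

section \<open>Actions as representations of the metric fundamental group\<close>

lemma ext_metric_actions_closed:
  "\<lbrakk>F \<in> ext_metric_actions X G; x \<in> mspace X; x' \<in> mspace X\<rbrakk> \<Longrightarrow> F x x' \<in> carrier G"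
  unfolding ext_metric_actions_def by (blast dest: PiE_mem)

lemma ext_metric_actions_self:
  "\<lbrakk>F \<in> ext_metric_actions X G; x \<in> mspace X\<rbrakk> \<Longrightarrow> F x x = \<one>\<^bsub>G\<^esub>"
  unfolding ext_metric_actions_def by blast

lemma ext_metric_actions_inv:
  "\<lbrakk>F \<in> ext_metric_actions X G; x \<in> mspace X; x' \<in> mspace X\<rbrakk> \<Longrightarrow> F x x' = inv\<^bsub>G\<^esub> (F x' x)"
  unfolding ext_metric_actions_def by blast

lemma ext_metric_actions_edist:
  "\<lbrakk>F \<in> ext_metric_actions X G; x \<in> mspace X; x' \<in> mspace X; x'' \<in> mspace X\<rbrakk> \<Longrightarrow>
     edist G (F x' x'' \<otimes>\<^bsub>G\<^esub> F x x') (F x x'') \<le> ennreal (mdist X x x' + mdist X x' x'' - mdist X x x'')"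
  unfolding ext_metric_actions_def by blast

lemmas ext_metric_actions_rules =
  ext_metric_actions_closed ext_metric_actions_self ext_metric_actions_edist

lemma is_category_EPMet:
  assumes "group G"
  shows "is_category (EPMet X G)"
proof -
  interpret group G by fact
  have "(F'' x x' \<otimes>\<^bsub>G\<^esub> (\<theta>' x \<otimes>\<^bsub>G\<^esub> \<theta> x)) = (\<theta>' x' \<otimes>\<^bsub>G\<^esub> \<theta> x') \<otimes>\<^bsub>G\<^esub> F x x'"
    if "F \<in> ext_metric_actions X G" "F' \<in> ext_metric_actions X G" "F'' \<in> ext_metric_actions X G"
      "\<theta> \<in> mspace X \<rightarrow>\<^sub>E carrier G" "\<theta>' \<in> mspace X \<rightarrow>\<^sub>E carrier G" "x \<in> mspace X" "x' \<in> mspace X"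
      "F' x x' \<otimes>\<^bsub>G\<^esub> \<theta> x = \<theta> x' \<otimes>\<^bsub>G\<^esub> F x x'" "F'' x x' \<otimes>\<^bsub>G\<^esub> \<theta>' x = \<theta>' x' \<otimes>\<^bsub>G\<^esub> F' x x'"
    for F F' F'' \<theta> \<theta>' x x'
  proof -
    have c: "F x x' \<in> carrier G" "F' x x' \<in> carrier G" "F'' x x' \<in> carrier G" "\<theta> x \<in> carrier G"
      "\<theta>' x \<in> carrier G" "\<theta> x' \<in> carrier G" "\<theta>' x' \<in> carrier G"
      using that by (auto simp: ext_metric_actions_closed)
    have "F'' x x' \<otimes>\<^bsub>G\<^esub> (\<theta>' x \<otimes>\<^bsub>G\<^esub> \<theta> x) = \<theta>' x' \<otimes>\<^bsub>G\<^esub> (F' x x' \<otimes>\<^bsub>G\<^esub> \<theta> x)"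
      using c that(9) by (simp flip: m_assoc)
    then show ?thesis using c that(8) by (simp add: m_assoc)
  qed
  then show ?thesis
    unfolding is_category_def EPMet_def
    by (auto simp: PiE_iff ext_metric_actions_closed m_assoc intro!: extensionalityI[of _ "mspace X"])
qed

lemma is_category_Hom:
  assumes "group H" "group G"
  shows "is_category (Hom H G)"
proof -
  interpret group G by fact
  have c: "\<phi> a \<in> carrier G" if "\<phi> \<in> emgroup_hom H G" "a \<in> carrier H" for \<phi> a
    using that by (auto simp: emgroup_hom_def hom_def)
  then show ?thesis
    unfolding is_category_def Hom_def by (auto simp: m_assoc inv_mult_group)
qed

text \<open>Written without an inverse, conjugation takes the shape of the naturality condition for
  transformations of actions.\<close>

lemma Hom_arrow_iff:
  assumes "group G" "\<phi> \<in> emgroup_hom H G" "\<psi> \<in> emgroup_hom H G"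
  shows "h \<in> cat_hom (Hom H G) \<phi> \<psi> \<longleftrightarrow>
    h \<in> carrier G \<and> (\<forall>a\<in>carrier H. \<psi> a \<otimes>\<^bsub>G\<^esub> h = h \<otimes>\<^bsub>G\<^esub> \<phi> a)"
proof -
  interpret group G by fact
  have c: "\<phi> a \<in> carrier G" "\<psi> a \<in> carrier G" if "a \<in> carrier H" for a
    using that assms by (auto simp: emgroup_hom_def hom_def)
  have "\<phi> a = inv\<^bsub>G\<^esub> h \<otimes>\<^bsub>G\<^esub> \<psi> a \<otimes>\<^bsub>G\<^esub> h \<longleftrightarrow> \<psi> a \<otimes>\<^bsub>G\<^esub> h = h \<otimes>\<^bsub>G\<^esub> \<phi> a"
    if "h \<in> carrier G" "a \<in> carrier H" for a
    using that c[of a] inv_solve_left[of "\<phi> a" h "\<psi> a \<otimes>\<^bsub>G\<^esub> h"] by (auto simp: m_assoc)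
  then show ?thesis by (auto simp: Hom_def)
qed

section \<open>Holonomy of an action along a word\<close>

text \<open>The element of a word \<open>[a\<^sub>0, ..., a\<^sub>k]\<close> is \<open>F a\<^sub>1 a\<^sub>0 \<otimes> ... \<otimes> F a\<^sub>k a\<^bsub>k-1\<^esub>\<close>, a map from
  the fiber over the last letter to the fiber over the first one. Words are read backwards
  because loops compose from left to right and maps from right to left.\<close>

fun holonomy :: "('g, 'm) emgroup_scheme \<Rightarrow> ('x \<Rightarrow> 'x \<Rightarrow> 'g) \<Rightarrow> 'x list \<Rightarrow> 'g" where
  "holonomy G F (a # b # l) = F b a \<otimes>\<^bsub>G\<^esub> holonomy G F (b # l)"
| "holonomy G F l = \<one>\<^bsub>G\<^esub>"

context extended_metric_group
begin

lemma edist_self: "g \<in> carrier G \<Longrightarrow> edist G g g = 0"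
  by (simp add: edist_eq_0_iff)

lemma edist_mult_left:
  "\<lbrakk>g \<in> carrier G; h \<in> carrier G; h' \<in> carrier G\<rbrakk> \<Longrightarrow> edist G (g \<otimes> h) (g \<otimes> h') \<le> edist G h h'"
  using mult_lipschitz[of g h g h'] edist_self[of g] by simp

lemma edist_mult_right:
  "\<lbrakk>g \<in> carrier G; h \<in> carrier G; h' \<in> carrier G\<rbrakk> \<Longrightarrow> edist G (h \<otimes> g) (h' \<otimes> g) \<le> edist G h h'"
  using mult_lipschitz[of h g h' g] edist_self[of g] by simp

context
  fixes X :: "'x metric" and F :: "'x \<Rightarrow> 'x \<Rightarrow> 'g"
  assumes F: "F \<in> ext_metric_actions X G"
begin

lemma holonomy_closed: "set l \<subseteq> mspace X \<Longrightarrow> holonomy G F l \<in> carrier G"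
  by (induction l rule: induct_list012) (auto simp: ext_metric_actions_closed[OF F])

lemma holonomy_append:
  "set (p @ a # q) \<subseteq> mspace X \<Longrightarrow>
    holonomy G F (p @ a # q) = holonomy G F (p @ [a]) \<otimes> holonomy G F (a # q)"
proof (induction p)
  case (Cons b p)
  have c: "holonomy G F (p @ [a]) \<in> carrier G" "holonomy G F (a # q) \<in> carrier G"
    using Cons.prems by (auto intro!: holonomy_closed)
  show ?case
    using Cons c by (cases p) (auto simp: m_assoc ext_metric_actions_closed[OF F])
qed (simp add: holonomy_closed)

text \<open>Deleting a letter changes only the two factors next to it, and multiplication by the other factors
  does not increase distances.\<close>

lemma holonomy_delete:
  assumes "set (p @ [a, b, c] @ q) \<subseteq> mspace X"
  shows "edist G (holonomy G F (p @ [a, c] @ q)) (holonomy G F (p @ [a, b, c] @ q))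
    \<le> edist G (F b a \<otimes> F c b) (F c a)"
proof -
  have m: "a \<in> mspace X" "b \<in> mspace X" "c \<in> mspace X" using assms by auto
  have Fc: "F b a \<in> carrier G" "F c b \<in> carrier G" "F c a \<in> carrier G"
    using m F by (simp_all add: ext_metric_actions_closed)
  let ?p = "holonomy G F (p @ [a])" and ?q = "holonomy G F (c # q)"
  have c: "?p \<in> carrier G" "?q \<in> carrier G" using assms by (auto intro!: holonomy_closed)
  have "holonomy G F (p @ [a, c] @ q) = ?p \<otimes> (F c a \<otimes> ?q)"
    using holonomy_append[of p a "c # q"] assms by simp
  moreover have "holonomy G F (p @ [a, b, c] @ q) = ?p \<otimes> ((F b a \<otimes> F c b) \<otimes> ?q)"
    using holonomy_append[of p a "b # c # q"] assms Fc c by (simp add: m_assoc)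
  ultimately have "edist G (holonomy G F (p @ [a, c] @ q)) (holonomy G F (p @ [a, b, c] @ q))
      \<le> edist G (F c a \<otimes> ?q) ((F b a \<otimes> F c b) \<otimes> ?q)"
    using Fc c by (simp add: edist_mult_left)
  also have "\<dots> \<le> edist G (F c a) (F b a \<otimes> F c b)" using Fc c by (intro edist_mult_right) auto
  finally show ?thesis using Fc by (simp add: edist_commute)
qed

end

end

text \<open>The conditions on entries by index exclude both ends, but there \<open>u\<close> and \<open>v\<close> have the
  base point in common. Hence the loops agree as lists outside the deleted letter.\<close>

lemma loop_edgeE:
  assumes "loop_edge X x u v w"
  obtains p a b c q where "u = p @ [a, c] @ q" "v = p @ [a, b, c] @ q" "v \<in> loops X x"
    "w = (if a \<noteq> c then mdist X a b + mdist X b c - mdist X a c else 0)"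
proof -
  obtain n j where u: "u \<in> loops_n X x n" and v: "v \<in> loops_n X x (n + 1)" and j: "j \<le> n"
    and l: "\<forall>i. 1 \<le> i \<and> i \<le> j \<longrightarrow> u ! i = v ! i"
    and r: "\<forall>i. j + 1 \<le> i \<and> i \<le> n \<longrightarrow> u ! i = v ! (i + 1)"
    and w: "w = (if v ! j \<noteq> v ! (j + 2)
             then mdist X (v ! j) (v ! (j + 1)) + mdist X (v ! (j + 1)) (v ! (j + 2))
                  - mdist X (v ! j) (v ! (j + 2)) else 0)"
    using assms unfolding loop_edge_def by blast
  have len: "length u = n + 2" "length v = n + 3" using u v by (simp_all add: loops_n_def)
  have l': "u ! i = v ! i" if "i \<le> j" for i
    using l that u v by (cases "i = 0") (simp_all add: loops_n_def)
  have r': "u ! i = v ! (i + 1)" if "j + 1 \<le> i" "i \<le> n + 1" for i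
    using r that u v by (cases "i = n + 1") (simp_all add: loops_n_def)
  let ?p = "take j v" and ?q = "drop (j + 3) v"
  have ve: "v = ?p @ [v ! j, v ! (j + 1), v ! (j + 2)] @ ?q"
    using len j by (simp add: Cons_nth_drop_Suc numeral_3_eq_3 id_take_nth_drop[symmetric])
  moreover have "u = ?p @ [v ! j, v ! (j + 2)] @ ?q"
  proof (rule nth_equalityI)
    fix i assume i: "i < length u"
    consider "i < j" | "i = j" | "i = j + 1" | k where "i = j + 2 + k"
      by (metis add.commute add_2_eq_Suc' le_add_diff_inverse not_less less_Suc_eq Suc_eq_plus1 add.left_commute)
    then show "u ! i = (?p @ [v ! j, v ! (j + 2)] @ ?q) ! i"
    proof cases
      case 4
      then show ?thesis using i j len r'[of i] by (simp add: nth_append algebra_simps eval_nat_numeral)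
    qed (use i j len l'[of i] r'[of i] in \<open>simp_all add: nth_append\<close>)
  qed (use len j in simp)
  ultimately show ?thesis using that w loopsI[OF v] by metis
qed

lemma loops_set: "u \<in> loops X x \<Longrightarrow> set u \<subseteq> mspace X"
  by (auto simp: loops_def loops_n_def)

lemma loops_hd: "u \<in> loops X x \<Longrightarrow> \<exists>l. u = x # l"
  by (cases u) (auto simp: loops_def loops_n_def)

lemma loops_last: "u \<in> loops X x \<Longrightarrow> \<exists>l. u = l @ [x]"
  by (cases u rule: rev_cases) (auto simp: loops_def loops_n_def nth_append)

lemma loops_iff:
  "u \<in> loops X x \<longleftrightarrow> set u \<subseteq> mspace X \<and> 2 \<le> length u \<and> hd u = x \<and> last u = x"
proof
  assume "u \<in> loops X x"
  then obtain n where u: "u \<in> loops_n X x n" by (rule loopsE)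
  then have "u \<noteq> []" by (auto simp: loops_n_def)
  with u show "set u \<subseteq> mspace X \<and> 2 \<le> length u \<and> hd u = x \<and> last u = x"
    by (simp add: loops_n_def hd_conv_nth last_conv_nth)
next
  assume u: "set u \<subseteq> mspace X \<and> 2 \<le> length u \<and> hd u = x \<and> last u = x"
  then have "u \<noteq> []" by auto
  moreover have "Suc (length u - 2) = length u - 1" using u by linarith
  ultimately have "u \<in> loops_n X x (length u - 2)"
    using u by (auto simp: loops_n_def hd_conv_nth last_conv_nth)
  then show "u \<in> loops X x" by (rule loopsI)
qed

context extended_metric_group
begin

context
  fixes X :: "'x metric" and F :: "'x \<Rightarrow> 'x \<Rightarrow> 'g"
  assumes F: "F \<in> ext_metric_actions X G"
begin

text \<open>The weight of an edge is the defect of the triangle inequality that bounds the failure of an action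
  to be functorial, so holonomy does not increase distances.\<close>

lemma holonomy_loop_edge:
  assumes "loop_edge X x u v w"
  shows "edist G (holonomy G F u) (holonomy G F v) \<le> ennreal w"
proof -
  obtain p a b c q where e: "u = p @ [a, c] @ q" "v = p @ [a, b, c] @ q" "v \<in> loops X x"
    "w = (if a \<noteq> c then mdist X a b + mdist X b c - mdist X a c else 0)"
    using assms by (rule loop_edgeE)
  have s: "set (p @ [a, b, c] @ q) \<subseteq> mspace X" using loops_set[OF e(3)] e(2) by simp
  then have m: "a \<in> mspace X" "b \<in> mspace X" "c \<in> mspace X" by auto
  have "edist G (F b a \<otimes> F c b) (F c a) \<le> ennreal w"
  proof (cases "a = c")
    case True
    \<comment> \<open>Backtracking costs nothing, since \<open>F b a\<close> and \<open>F a b\<close> are inverse to each other.\<close>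
    then have "F b a \<otimes> F c b = F c a"
      using m F ext_metric_actions_inv[OF F, of b a] by (simp add: ext_metric_actions_rules)
    then show ?thesis using m F by (simp add: edist_self ext_metric_actions_closed)
  next
    case False
    then show ?thesis
      using ext_metric_actions_edist[OF F, of c b a] m e(4) by (simp add: mdist_commute add.commute)
  qed
  then show ?thesis using holonomy_delete[OF F s] e by (meson order_trans)
qed

lemma holonomy_loop_path:
  "loop_path X x u s v \<Longrightarrow> edist G (holonomy G F u) (holonomy G F v) \<le> ennreal s"
proof (induction rule: loop_path.induct)
  case (refl u)
  then show ?case using holonomy_closed[OF F loops_set[OF refl]] by (simp add: edist_self)
next
  case (step u s v v' w)
  note l = loop_path_loops[OF loop_path.step[OF step.hyps]] loop_path_loops[OF step.hyps(1)]
  then have c: "holonomy G F u \<in> carrier G" "holonomy G F v \<in> carrier G" "holonomy G F v' \<in> carrier G"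
    by (auto intro!: holonomy_closed[OF F] loops_set)
  have "edist G (holonomy G F v) (holonomy G F v') \<le> ennreal w"
    using step.hyps(2) holonomy_loop_edge c by (metis edist_commute)
  moreover have "0 \<le> w" using step.hyps(2) loop_edge_nonneg by metis
  ultimately show ?case
    using edist_triangle[OF c] step.IH loop_path_nonneg[OF step.hyps(1)]
    by (simp add: ennreal_plus) (meson add_mono order_trans)
qed

lemma holonomy_loop_dist:
  "edist G (holonomy G F u) (holonomy G F v) \<le> loop_dist X x u v"
  unfolding loop_dist_def by (rule Inf_greatest) (use holonomy_loop_path in blast)

text \<open>The naturality squares of successive letters are pasted together.\<close>

lemma holonomy_transformation:
  assumes F': "F' \<in> ext_metric_actions X G" and \<theta>: "\<theta> \<in> cat_hom (EPMet X G) F F'"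
  shows "\<lbrakk>set l \<subseteq> mspace X; l \<noteq> []\<rbrakk> \<Longrightarrow>
    holonomy G F' l \<otimes> \<theta> (last l) = \<theta> (hd l) \<otimes> holonomy G F l"
proof (induction l rule: induct_list012)
  case (3 a b l)
  have t: "\<theta> z \<in> carrier G" if "z \<in> mspace X" for z using \<theta> that by (auto simp: EPMet_def)
  have nat: "F' b a \<otimes> \<theta> b = \<theta> a \<otimes> F b a" using \<theta> 3 by (auto simp: EPMet_def)
  have m: "a \<in> mspace X" "b \<in> mspace X" "last (b # l) \<in> mspace X"
    using 3(3) last_in_set[of "b # l"] by auto
  have c: "holonomy G F (b # l) \<in> carrier G" "holonomy G F' (b # l) \<in> carrier G"
    "F b a \<in> carrier G" "F' b a \<in> carrier G"
    using 3(3) m by (auto intro!: holonomy_closed F F' ext_metric_actions_closed[OF F] ext_metric_actions_closed[OF F'])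
  have "holonomy G F' (a # b # l) \<otimes> \<theta> (last (b # l)) = F' b a \<otimes> (holonomy G F' (b # l) \<otimes> \<theta> (last (b # l)))"
    using c t[OF m(3)] by (simp add: m_assoc del: last.simps)
  also have "\<dots> = F' b a \<otimes> (\<theta> b \<otimes> holonomy G F (b # l))"
    using 3 by simp
  also have "\<dots> = (F' b a \<otimes> \<theta> b) \<otimes> holonomy G F (b # l)"
    using c t m by (simp add: m_assoc)
  also have "\<dots> = \<theta> a \<otimes> holonomy G F (a # b # l)"
    unfolding nat using c t m by (simp add: m_assoc)
  finally show ?case by simp
qed (use \<theta> in \<open>auto simp: EPMet_def PiE_iff\<close>)

end

end

section \<open>From representations to actions\<close>

abbreviation loop_class :: "'x metric \<Rightarrow> 'x \<Rightarrow> 'x list \<Rightarrow> 'x list set" where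
  "loop_class X x u \<equiv> loop_rel X x `` {u}"

lemma loop_class_carrier: "u \<in> loops X x \<Longrightarrow> loop_class X x u \<in> carrier (pi1m X x)"
  by (simp add: pi1m_def quotientI)

text \<open>All three cases are edges of weight \<open>0\<close>: the triangle is degenerate if the letter repeats
  a neighbour, and backtracks have weight \<open>0\<close> by definition.\<close>

lemma loop_class_delete:
  assumes "p @ [a, b, c] @ q \<in> loops X x" "a = b \<or> b = c \<or> a = c"
  shows "loop_class X x (p @ [a, b, c] @ q) = loop_class X x (p @ [a, c] @ q)"
proof -
  have "a \<in> mspace X" "b \<in> mspace X" "c \<in> mspace X" using loops_set[OF assms(1)] by auto
  then have weight: "(if a \<noteq> c then mdist X a b + mdist X b c - mdist X a c else 0) = 0"
    using assms(2) by auto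
  have "loop_edge X x (p @ [a, c] @ q) (p @ [a, b, c] @ q) 0"
    using loop_edge_delete[OF assms(1)] unfolding weight .
  then show ?thesis by (intro pi1m_class_eq loop_path_edge)
qed

lemma emgroup_homD:
  assumes "\<phi> \<in> emgroup_hom H G"
  shows "a \<in> carrier H \<Longrightarrow> \<phi> a \<in> carrier G"
    and "\<lbrakk>a \<in> carrier H; b \<in> carrier H\<rbrakk> \<Longrightarrow> \<phi> (a \<otimes>\<^bsub>H\<^esub> b) = \<phi> a \<otimes>\<^bsub>G\<^esub> \<phi> b"
    and "\<lbrakk>a \<in> carrier H; b \<in> carrier H\<rbrakk> \<Longrightarrow> edist G (\<phi> a) (\<phi> b) \<le> edist H a b"
  using assms by (auto simp: emgroup_hom_def hom_def)

text \<open>The loop runs through \<open>x'\<close> before \<open>x\<close>, for the same reason that holonomy reads words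
  backwards.\<close>

definition loop_action :: "'x metric \<Rightarrow> 'x \<Rightarrow> ('x list set \<Rightarrow> 'g) \<Rightarrow> 'x \<Rightarrow> 'x \<Rightarrow> 'g" where
  "loop_action X x\<^sub>0 \<phi> = (\<lambda>x\<in>mspace X. \<lambda>x'\<in>mspace X. \<phi> (loop_class X x\<^sub>0 [x\<^sub>0, x', x, x\<^sub>0]))"

context
  fixes X :: "'x metric" and x\<^sub>0 :: 'x and G :: "('g, 'm) emgroup_scheme"
  assumes x\<^sub>0: "x\<^sub>0 \<in> mspace X" and G: "extended_metric_group G"
begin

interpretation extended_metric_group G by (rule G)

interpretation pi: metric_group "pi1m X x\<^sub>0" by (rule metric_group_pi1m[OF x\<^sub>0])

lemma emgroup_hom_one: "\<phi> \<in> emgroup_hom (pi1m X x\<^sub>0) G \<Longrightarrow> \<phi> (loop_class X x\<^sub>0 [x\<^sub>0, x\<^sub>0]) = \<one>\<^bsub>G\<^esub>"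
  using hom_one[of \<phi> "pi1m X x\<^sub>0" G] pi.is_group is_group
  by (auto simp: emgroup_hom_def pi1m_def)

lemma emgroup_hom_loop_append:
  assumes "\<phi> \<in> emgroup_hom (pi1m X x\<^sub>0) G" "u \<in> loops X x\<^sub>0" "v \<in> loops X x\<^sub>0"
  shows "\<phi> (loop_class X x\<^sub>0 u) \<otimes>\<^bsub>G\<^esub> \<phi> (loop_class X x\<^sub>0 v) = \<phi> (loop_class X x\<^sub>0 (u @ tl v))"
  using emgroup_homD(2)[OF assms(1), of "loop_class X x\<^sub>0 u" "loop_class X x\<^sub>0 v"]
  by (simp add: assms loop_class_carrier pi1m_mult_class)

text \<open>Joining the two triangles passes through the base point between two visits of \<open>b\<close>. This is a
  backtrack, and what remains is a repeated letter.\<close>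

lemma loop_action_mult:
  assumes \<phi>: "\<phi> \<in> emgroup_hom (pi1m X x\<^sub>0) G" and m: "a \<in> mspace X" "b \<in> mspace X" "c \<in> mspace X"
  shows "loop_action X x\<^sub>0 \<phi> b c \<otimes>\<^bsub>G\<^esub> loop_action X x\<^sub>0 \<phi> a b = \<phi> (loop_class X x\<^sub>0 [x\<^sub>0, c, b, a, x\<^sub>0])"
proof -
  have "loop_action X x\<^sub>0 \<phi> b c \<otimes>\<^bsub>G\<^esub> loop_action X x\<^sub>0 \<phi> a b
      = \<phi> (loop_class X x\<^sub>0 ([x\<^sub>0, c] @ [b, x\<^sub>0, b] @ [a, x\<^sub>0]))"
    using emgroup_hom_loop_append[OF \<phi>, of "[x\<^sub>0, c, b, x\<^sub>0]" "[x\<^sub>0, b, a, x\<^sub>0]"] m x\<^sub>0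
    by (simp add: loop_action_def loops_iff)
  also have "loop_class X x\<^sub>0 ([x\<^sub>0, c] @ [b, x\<^sub>0, b] @ [a, x\<^sub>0]) = loop_class X x\<^sub>0 ([x\<^sub>0, c] @ [b, b] @ [a, x\<^sub>0])"
    using m x\<^sub>0 by (intro loop_class_delete) (auto simp: loops_iff)
  also have "\<dots> = loop_class X x\<^sub>0 ([x\<^sub>0] @ [c, b, b] @ [a, x\<^sub>0])" by simp
  also have "\<dots> = loop_class X x\<^sub>0 ([x\<^sub>0] @ [c, b] @ [a, x\<^sub>0])"
    using m x\<^sub>0 by (intro loop_class_delete) (auto simp: loops_iff)
  finally show ?thesis by simp
qed

lemma loop_action_self:
  assumes \<phi>: "\<phi> \<in> emgroup_hom (pi1m X x\<^sub>0) G" and m: "a \<in> mspace X"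
  shows "loop_action X x\<^sub>0 \<phi> a a = \<one>\<^bsub>G\<^esub>"
proof -
  have "loop_class X x\<^sub>0 ([] @ [x\<^sub>0, a, a] @ [x\<^sub>0]) = loop_class X x\<^sub>0 ([] @ [x\<^sub>0, a] @ [x\<^sub>0])"
    using m x\<^sub>0 by (intro loop_class_delete) (auto simp: loops_iff)
  also have "\<dots> = loop_class X x\<^sub>0 ([] @ [x\<^sub>0, a, x\<^sub>0] @ [])" by simp
  also have "\<dots> = loop_class X x\<^sub>0 ([] @ [x\<^sub>0, x\<^sub>0] @ [])"
    using m x\<^sub>0 by (intro loop_class_delete) (auto simp: loops_iff)
  finally show ?thesis using emgroup_hom_one[OF \<phi>] m by (simp add: loop_action_def)
qed

text \<open>The product for \<open>a\<close>, \<open>b\<close>, \<open>c\<close> is the image of a loop through all three points, and deleting \<open>b\<close>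
  from it is an edge whose weight is the right hand side of the inequality for actions.\<close>

lemma loop_action_in_actions:
  assumes \<phi>: "\<phi> \<in> emgroup_hom (pi1m X x\<^sub>0) G"
  shows "loop_action X x\<^sub>0 \<phi> \<in> ext_metric_actions X G"
proof -
  let ?F = "loop_action X x\<^sub>0 \<phi>"
  have closed: "?F a b \<in> carrier G" if "a \<in> mspace X" "b \<in> mspace X" for a b
    using that x\<^sub>0 by (auto simp: loop_action_def loops_iff intro!: emgroup_homD[OF \<phi>] loop_class_carrier)
  have "?F a b = inv\<^bsub>G\<^esub> ?F b a" if m: "a \<in> mspace X" "b \<in> mspace X" for a b
  proof -
    have "loop_class X x\<^sub>0 ([x\<^sub>0] @ [b, a, b] @ [x\<^sub>0]) = loop_class X x\<^sub>0 ([x\<^sub>0] @ [b, b] @ [x\<^sub>0])"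
      using m x\<^sub>0 by (intro loop_class_delete) (auto simp: loops_iff)
    then have "?F a b \<otimes>\<^bsub>G\<^esub> ?F b a = ?F b b"
      using m by (simp add: loop_action_mult[OF \<phi>]) (simp add: loop_action_def)
    then show ?thesis
      using m closed loop_action_self[OF \<phi>] by (simp add: inv_equality)
  qed
  moreover have "edist G (?F b c \<otimes>\<^bsub>G\<^esub> ?F a b) (?F a c) \<le> ennreal (mdist X a b + mdist X b c - mdist X a c)"
    if m: "a \<in> mspace X" "b \<in> mspace X" "c \<in> mspace X" for a b c
  proof -
    have l: "[x\<^sub>0] @ [c, b, a] @ [x\<^sub>0] \<in> loops X x\<^sub>0" "[x\<^sub>0, c, a, x\<^sub>0] \<in> loops X x\<^sub>0"
      using m x\<^sub>0 by (auto simp: loops_iff)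
    have "edist G (?F b c \<otimes>\<^bsub>G\<^esub> ?F a b) (?F a c) \<le>
        loop_dist X x\<^sub>0 ([x\<^sub>0] @ [c, b, a] @ [x\<^sub>0]) ([x\<^sub>0] @ [c, a] @ [x\<^sub>0])"
      using emgroup_homD(3)[OF \<phi> loop_class_carrier[OF l(1)] loop_class_carrier[OF l(2)]] m l
      by (simp add: loop_action_mult[OF \<phi>] pi1m_edist_class) (simp add: loop_action_def)
    also have "\<dots> \<le> ennreal (if c \<noteq> a then mdist X c b + mdist X b a - mdist X c a else 0)"
      by (rule loop_dist_le[OF loop_path_edge(2)[OF loop_edge_delete[OF l(1)]]])
    also have "\<dots> \<le> ennreal (mdist X a b + mdist X b c - mdist X a c)"
      using m by (auto simp: mdist_commute add.commute)
    finally show ?thesis .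
  qed
  moreover have "?F \<in> mspace X \<rightarrow>\<^sub>E (mspace X \<rightarrow>\<^sub>E carrier G)"
    using closed by (simp add: PiE_iff) (simp add: loop_action_def)
  ultimately show ?thesis
    using loop_action_self[OF \<phi>] unfolding ext_metric_actions_def by blast
qed

text \<open>A detour to the base point at every letter consists of backtracks, so a loop is the product of the
  triangles over its successive letters. These triangles are what defines the action.\<close>

lemma holonomy_loop_action:
  assumes \<phi>: "\<phi> \<in> emgroup_hom (pi1m X x\<^sub>0) G" and u: "u \<in> loops X x\<^sub>0"
  shows "holonomy G (loop_action X x\<^sub>0 \<phi>) u = \<phi> (loop_class X x\<^sub>0 u)"
proof -
  have *: "holonomy G (loop_action X x\<^sub>0 \<phi>) l = \<phi> (loop_class X x\<^sub>0 (x\<^sub>0 # l))"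
    if "set l \<subseteq> mspace X" "l \<noteq> []" "last l = x\<^sub>0" for l
    using that
  proof (induction l rule: induct_list012)
    case (2 a)
    then show ?case using emgroup_hom_one[OF \<phi>] by simp
  next
    case (3 a b l)
    have act: "loop_action X x\<^sub>0 \<phi> b a = \<phi> (loop_class X x\<^sub>0 [x\<^sub>0, a, b, x\<^sub>0])"
      using 3 by (simp add: loop_action_def)
    have "holonomy G (loop_action X x\<^sub>0 \<phi>) (a # b # l) =
        \<phi> (loop_class X x\<^sub>0 [x\<^sub>0, a, b, x\<^sub>0]) \<otimes>\<^bsub>G\<^esub> \<phi> (loop_class X x\<^sub>0 (x\<^sub>0 # b # l))"
      using 3 by (simp add: act)
    also have "\<dots> = \<phi> (loop_class X x\<^sub>0 ([x\<^sub>0, a, b, x\<^sub>0] @ tl (x\<^sub>0 # b # l)))"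
      using 3 x\<^sub>0 by (intro emgroup_hom_loop_append[OF \<phi>]) (auto simp: loops_iff)
    also have "[x\<^sub>0, a, b, x\<^sub>0] @ tl (x\<^sub>0 # b # l) = [x\<^sub>0, a] @ [b, x\<^sub>0, b] @ l" by simp
    also have "loop_class X x\<^sub>0 ([x\<^sub>0, a] @ [b, x\<^sub>0, b] @ l) = loop_class X x\<^sub>0 ([x\<^sub>0, a] @ [b, b] @ l)"
      using 3 x\<^sub>0 by (intro loop_class_delete) (auto simp: loops_iff)
    also have "\<dots> = loop_class X x\<^sub>0 ([x\<^sub>0] @ [a, b, b] @ l)" by simp
    also have "\<dots> = loop_class X x\<^sub>0 ([x\<^sub>0] @ [a, b] @ l)"
      using 3 x\<^sub>0 by (intro loop_class_delete) (auto simp: loops_iff)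
    finally show ?case by simp
  qed simp
  obtain b l where ue: "u = x\<^sub>0 # b # l" using u by (cases u; cases "tl u") (auto simp: loops_iff)
  have "loop_class X x\<^sub>0 ([] @ [x\<^sub>0, x\<^sub>0, b] @ l) = loop_class X x\<^sub>0 ([] @ [x\<^sub>0, b] @ l)"
    using u x\<^sub>0 ue by (intro loop_class_delete) (auto simp: loops_iff)
  then show ?thesis using *[of u] u ue by (simp add: loops_iff)
qed

text \<open>Loops of the same class are at distance \<open>0\<close>, so a function of loops that does not increase distances
  descends to the fundamental group.\<close>

lemma holonomy_representation:
  assumes F: "F \<in> ext_metric_actions X G"
  obtains \<phi> where "\<phi> \<in> emgroup_hom (pi1m X x\<^sub>0) G"
    "\<And>u. u \<in> loops X x\<^sub>0 \<Longrightarrow> \<phi> (loop_class X x\<^sub>0 u) = holonomy G F u"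
proof -
  let ?P = "pi1m X x\<^sub>0"
  define \<phi> where "\<phi> = (\<lambda>A\<in>carrier ?P. holonomy G F (SOME u. u \<in> A))"
  have cl: "holonomy G F u \<in> carrier G" if "u \<in> loops X x\<^sub>0" for u
    using holonomy_closed[OF F loops_set[OF that]] .
  have \<phi>: "\<phi> (loop_class X x\<^sub>0 u) = holonomy G F u" if u: "u \<in> loops X x\<^sub>0" for u
  proof -
    have "u \<in> loop_class X x\<^sub>0 u" using equiv_class_self[OF equiv_loop_rel u] .
    then have "(SOME v. v \<in> loop_class X x\<^sub>0 u) \<in> loop_class X x\<^sub>0 u" by (rule someI)
    then have v: "(SOME v. v \<in> loop_class X x\<^sub>0 u) \<in> loops X x\<^sub>0"
      "loop_dist X x\<^sub>0 u (SOME v. v \<in> loop_class X x\<^sub>0 u) = 0"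
      by (auto simp: loop_rel_def)
    have "edist G (holonomy G F u) (holonomy G F (SOME v. v \<in> loop_class X x\<^sub>0 u)) = 0"
      using holonomy_loop_dist[OF F, of u _ x\<^sub>0] v(2) by (metis le_zero_eq)
    then have "holonomy G F u = holonomy G F (SOME v. v \<in> loop_class X x\<^sub>0 u)"
      using edist_eq_0_iff cl u v(1) by blast
    then show ?thesis using u by (simp add: \<phi>_def loop_class_carrier)
  qed
  have "holonomy G F (u @ tl v) = holonomy G F u \<otimes>\<^bsub>G\<^esub> holonomy G F v"
    if "u \<in> loops X x\<^sub>0" "v \<in> loops X x\<^sub>0" for u v
  proof -
    obtain p where "u = p @ [x\<^sub>0]" using loops_last[OF \<open>u \<in> _\<close>] by (elim exE)
    moreover obtain q where "v = x\<^sub>0 # q" using loops_hd[OF \<open>v \<in> _\<close>] by (elim exE)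
    ultimately show ?thesis using holonomy_append[OF F, of p x\<^sub>0 q] that by (simp add: loops_iff)
  qed
  then have "\<phi> \<in> hom ?P G"
    by (auto simp: hom_def pi1m_mult_class \<phi> cl loops_append elim!: pi1m_carrier_cases)
  moreover have "edist G (\<phi> A) (\<phi> B) \<le> edist ?P A B" if "A \<in> carrier ?P" "B \<in> carrier ?P" for A B
    using that by (elim pi1m_carrier_cases) (simp add: \<phi> pi1m_edist_class holonomy_loop_dist[OF F])
  ultimately have "\<phi> \<in> emgroup_hom ?P G" by (simp add: emgroup_hom_def \<phi>_def)
  then show ?thesis using \<phi> by (rule that)
qed

text \<open>Conjugating elements correspond to constant transformations. Every transformation is constant
  here, because the actions are trivial between the base point and any other point. An arbitrary
  action \<open>F\<close> differs from the action of its own holonomy by the transformation \<open>F x\<^sub>0 x\<close>.\<close>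

lemma equivalence_functor_loop_action:
  "equivalence_functor (Hom (pi1m X x\<^sub>0) G) (EPMet X G) (loop_action X x\<^sub>0) (\<lambda>\<phi> \<psi> h. \<lambda>x\<in>mspace X. h)"
  (is "equivalence_functor ?H ?E ?F ?Fm")
proof -
  let ?P = "pi1m X x\<^sub>0"
  have triangle: "loop_class X x\<^sub>0 [x\<^sub>0, b, a, x\<^sub>0] \<in> carrier ?P" if "a \<in> mspace X" "b \<in> mspace X" for a b
    using that x\<^sub>0 by (intro loop_class_carrier) (simp add: loops_iff)
  have arrow: "?Fm \<phi> \<psi> h \<in> cat_hom ?E (?F \<phi>) (?F \<psi>)"
    if \<phi>: "\<phi> \<in> emgroup_hom ?P G" and \<psi>: "\<psi> \<in> emgroup_hom ?P G" and h: "h \<in> cat_hom ?H \<phi> \<psi>" for \<phi> \<psi> h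
    using h triangle unfolding Hom_arrow_iff[OF is_group \<phi> \<psi>]
    by (auto simp: EPMet_def) (simp add: loop_action_def)
  have "is_functor ?H ?E ?F ?Fm"
    unfolding is_functor_def
  proof (intro conjI ballI is_category_Hom is_category_EPMet is_group pi.is_group)
    fix \<phi> \<psi> h assume "\<phi> \<in> cat_obj ?H" "\<psi> \<in> cat_obj ?H" "h \<in> cat_hom ?H \<phi> \<psi>"
    then show "?Fm \<phi> \<psi> h \<in> cat_hom ?E (?F \<phi>) (?F \<psi>)" by (intro arrow) (simp_all add: Hom_def)
  qed (auto simp: Hom_def EPMet_def loop_action_in_actions)
  moreover have "bij_betw (?Fm \<phi> \<psi>) (cat_hom ?H \<phi> \<psi>) (cat_hom ?E (?F \<phi>) (?F \<psi>))"
    if \<phi>: "\<phi> \<in> emgroup_hom ?P G" and \<psi>: "\<psi> \<in> emgroup_hom ?P G" for \<phi> \<psi>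
    unfolding bij_betw_def
  proof (intro conjI subset_antisym subsetI)
    show "inj_on (?Fm \<phi> \<psi>) (cat_hom ?H \<phi> \<psi>)"
      using x\<^sub>0 by (auto simp: inj_on_def dest: fun_cong[of _ _ x\<^sub>0])
  next
    fix \<theta> assume "\<theta> \<in> ?Fm \<phi> \<psi> ` cat_hom ?H \<phi> \<psi>"
    then show "\<theta> \<in> cat_hom ?E (?F \<phi>) (?F \<psi>)" using arrow[OF \<phi> \<psi>] by auto
  next
    fix \<theta> assume \<theta>: "\<theta> \<in> cat_hom ?E (?F \<phi>) (?F \<psi>)"
    have t: "\<theta> x \<in> carrier G" if "x \<in> mspace X" for x using \<theta> that by (auto simp: EPMet_def)
    have F: "?F \<phi> \<in> ext_metric_actions X G" "?F \<psi> \<in> ext_metric_actions X G"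
      using \<phi> \<psi> by (simp_all add: loop_action_in_actions)
    \<comment> \<open>The loop of \<open>x\<^sub>0\<close> and \<open>x\<close> is a backtrack, hence both actions are trivial between \<open>x\<^sub>0\<close> and \<open>x\<close>.\<close>
    have base: "?F \<rho> x\<^sub>0 x = \<one>\<^bsub>G\<^esub>" if \<rho>: "\<rho> \<in> emgroup_hom ?P G" and x: "x \<in> mspace X" for \<rho> x
    proof -
      have "loop_class X x\<^sub>0 ([x\<^sub>0] @ [x, x\<^sub>0, x\<^sub>0] @ []) = loop_class X x\<^sub>0 ([x\<^sub>0] @ [x, x\<^sub>0] @ [])"
        using x x\<^sub>0 by (intro loop_class_delete) (auto simp: loops_iff)
      also have "\<dots> = loop_class X x\<^sub>0 ([] @ [x\<^sub>0, x, x\<^sub>0] @ [])" by simp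
      also have "\<dots> = loop_class X x\<^sub>0 ([] @ [x\<^sub>0, x\<^sub>0] @ [])"
        using x x\<^sub>0 by (intro loop_class_delete) (auto simp: loops_iff)
      finally show ?thesis using emgroup_hom_one[OF \<rho>] x x\<^sub>0 by (simp add: loop_action_def)
    qed
    have const: "\<theta> x = \<theta> x\<^sub>0" if "x \<in> mspace X" for x
    proof -
      have "?F \<psi> x\<^sub>0 x \<otimes>\<^bsub>G\<^esub> \<theta> x\<^sub>0 = \<theta> x \<otimes>\<^bsub>G\<^esub> ?F \<phi> x\<^sub>0 x"
        using \<theta> that x\<^sub>0 by (simp add: EPMet_def)
      then show ?thesis using that x\<^sub>0 by (simp add: base \<phi> \<psi> t)
    qed
    have "\<psi> A \<otimes>\<^bsub>G\<^esub> \<theta> x\<^sub>0 = \<theta> x\<^sub>0 \<otimes>\<^bsub>G\<^esub> \<phi> A" if "A \<in> carrier ?P" for A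
      using that
    proof (rule pi1m_carrier_cases)
      fix u assume u: "u \<in> loops X x\<^sub>0" "A = loop_class X x\<^sub>0 u"
      then have "u \<noteq> []" "hd u = x\<^sub>0" "last u = x\<^sub>0" by (auto simp: loops_iff)
      then show ?thesis
        using holonomy_transformation[OF F \<theta> loops_set[OF u(1)]] u
        by (simp add: holonomy_loop_action \<phi> \<psi>)
    qed
    then have "\<theta> x\<^sub>0 \<in> cat_hom ?H \<phi> \<psi>"
      unfolding Hom_arrow_iff[OF is_group \<phi> \<psi>] using t[OF x\<^sub>0] by blast
    moreover have "\<theta> = ?Fm \<phi> \<psi> (\<theta> x\<^sub>0)"
      using \<theta> const by (intro extensionalityI[of _ "mspace X"]) (auto simp: EPMet_def PiE_iff)
    ultimately show "\<theta> \<in> ?Fm \<phi> \<psi> ` cat_hom ?H \<phi> \<psi>" by blast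
  qed
  moreover have "\<exists>\<phi>\<in>emgroup_hom ?P G. cat_isos ?E (?F \<phi>) F \<noteq> {}" if F: "F \<in> ext_metric_actions X G" for F
  proof -
    obtain \<phi> where \<phi>: "\<phi> \<in> emgroup_hom ?P G"
      and h: "\<And>u. u \<in> loops X x\<^sub>0 \<Longrightarrow> \<phi> (loop_class X x\<^sub>0 u) = holonomy G F u"
      using holonomy_representation[OF F] by blast
    have Fc: "F a b \<in> carrier G" if "a \<in> mspace X" "b \<in> mspace X" for a b
      using that F by (simp add: ext_metric_actions_closed)
    have Finv: "F b a \<otimes>\<^bsub>G\<^esub> F a b = \<one>\<^bsub>G\<^esub>" if "a \<in> mspace X" "b \<in> mspace X" for a b
      using that ext_metric_actions_inv[OF F that] Fc by simp
    have Fact: "?F \<phi> a b = F b x\<^sub>0 \<otimes>\<^bsub>G\<^esub> (F a b \<otimes>\<^bsub>G\<^esub> F x\<^sub>0 a)" if "a \<in> mspace X" "b \<in> mspace X" for a b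
      using that x\<^sub>0 Fc h[of "[x\<^sub>0, b, a, x\<^sub>0]"] by (simp add: loop_action_def loops_iff)
    have cancel: "F b a \<otimes>\<^bsub>G\<^esub> (F a b \<otimes>\<^bsub>G\<^esub> g) = g" if "a \<in> mspace X" "b \<in> mspace X" "g \<in> carrier G" for a b g
      using that Finv[of a b] Fc by (simp flip: m_assoc)
    let ?\<theta> = "\<lambda>x\<in>mspace X. F x\<^sub>0 x" and ?\<theta>' = "\<lambda>x\<in>mspace X. F x x\<^sub>0"
    have "?\<theta> \<in> cat_hom ?E (?F \<phi>) F" "?\<theta>' \<in> cat_hom ?E F (?F \<phi>)"
      using x\<^sub>0 Fc by (auto simp: EPMet_def Fact cancel Finv m_assoc)
    moreover have "cat_comp ?E (?F \<phi>) F (?F \<phi>) ?\<theta>' ?\<theta> = cat_id ?E (?F \<phi>)"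
      "cat_comp ?E F (?F \<phi>) F ?\<theta> ?\<theta>' = cat_id ?E F"
      using x\<^sub>0 by (auto simp: EPMet_def Finv intro!: restrict_ext)
    ultimately show ?thesis using \<phi> by (auto simp: cat_isos_def)
  qed
  ultimately show ?thesis by (simp add: equivalence_functor_def) (simp add: Hom_def EPMet_def)
qed

end

section \<open>Actions as charts of metric fibrations\<close>

lemma isometries_apply: "\<lbrakk>f \<in> isometries M N; x \<in> mspace M\<rbrakk> \<Longrightarrow> f x \<in> mspace N"
  by (auto simp: isometries_def bij_betw_def)

lemma isometric_sym:
  assumes "isometric M N"
  shows "isometric N M"
proof -
  obtain f where b: "bij_betw f (mspace M) (mspace N)"
    and d: "\<And>x x'. \<lbrakk>x \<in> mspace M; x' \<in> mspace M\<rbrakk> \<Longrightarrow> mdist N (f x) (f x') = mdist M x x'"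
    using assms by (auto simp: isometric_def isometries_def)
  define g where "g = restrict (inv_into (mspace M) f) (mspace N)"
  have g: "g y \<in> mspace M" "f (g y) = y" if "y \<in> mspace N" for y
    using b that by (auto simp: g_def bij_betw_def inv_into_into f_inv_into_f)
  have "bij_betw g (mspace N) (mspace M)"
    unfolding g_def using bij_betw_inv_into[OF b] by simp
  moreover have "mdist M (g y) (g y') = mdist N y y'" if "y \<in> mspace N" "y' \<in> mspace N" for y y'
    using d[of "g y" "g y'"] g that by simp
  ultimately have "g \<in> isometries N M" by (auto simp: isometries_def g_def)
  then show ?thesis by (auto simp: isometric_def)
qed

lemma edist_Aut_le_iff:
  "0 \<le> c \<Longrightarrow> edist (Aut Y) f g \<le> ennreal c \<longleftrightarrow> (\<forall>y\<in>mspace Y. mdist Y (f y) (g y) \<le> c)"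
  by (simp add: Aut_def SUP_le_iff ennreal_le_iff)

text \<open>Equality in \<open>Aut Y\<close> and bounds on its supremum distance are conditions on single points of \<open>Y\<close>.\<close>

lemma Aut_actionsI:
  assumes ext: "F \<in> extensional (mspace X)" "\<And>x. x \<in> mspace X \<Longrightarrow> F x \<in> extensional (mspace X)"
    and iso: "\<And>x x'. \<lbrakk>x \<in> mspace X; x' \<in> mspace X\<rbrakk> \<Longrightarrow> F x x' \<in> isometries Y Y"
    and self: "\<And>x y. \<lbrakk>x \<in> mspace X; y \<in> mspace Y\<rbrakk> \<Longrightarrow> F x x y = y"
    and inv: "\<And>x x' y. \<lbrakk>x \<in> mspace X; x' \<in> mspace X; y \<in> mspace Y\<rbrakk> \<Longrightarrow> F x x' (F x' x y) = y"
    and dist: "\<And>x x' x'' y. \<lbrakk>x \<in> mspace X; x' \<in> mspace X; x'' \<in> mspace X; y \<in> mspace Y\<rbrakk> \<Longrightarrow>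
      mdist Y (F x' x'' (F x x' y)) (F x x'' y) \<le> mdist X x x' + mdist X x' x'' - mdist X x x''"
  shows "F \<in> ext_metric_actions X (Aut Y)"
proof -
  interpret extended_metric_group "Aut Y" by (rule extended_metric_group_Aut)
  have closed: "F x x' \<in> carrier (Aut Y)" if "x \<in> mspace X" "x' \<in> mspace X" for x x'
    using iso that by (simp add: Aut_def)
  have "F x x = \<one>\<^bsub>Aut Y\<^esub>" if "x \<in> mspace X" for x
    using iso[of x x] self that
    by (intro extensionalityI[of _ "mspace Y"]) (auto simp: Aut_def isometries_def)
  moreover have "F x x' = inv\<^bsub>Aut Y\<^esub> (F x' x)" if "x \<in> mspace X" "x' \<in> mspace X" for x x'
  proof -
    have "F x x' \<otimes>\<^bsub>Aut Y\<^esub> F x' x = \<one>\<^bsub>Aut Y\<^esub>"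
      using inv that by (auto simp: Aut_def compose_def intro!: restrict_ext)
    then show ?thesis using closed that inv_equality[of "F x x'" "F x' x"] by simp
  qed
  moreover have "edist (Aut Y) (F x' x'' \<otimes>\<^bsub>Aut Y\<^esub> F x x') (F x x'')
      \<le> ennreal (mdist X x x' + mdist X x' x'' - mdist X x x'')"
    if "x \<in> mspace X" "x' \<in> mspace X" "x'' \<in> mspace X" for x x' x''
    using dist[OF that] mdist_triangle[OF that]
    by (subst edist_Aut_le_iff) (simp_all add: Aut_def compose_def)
  moreover have "F \<in> mspace X \<rightarrow>\<^sub>E (mspace X \<rightarrow>\<^sub>E carrier (Aut Y))"
    using ext closed by (simp add: PiE_iff)
  ultimately show ?thesis unfolding ext_metric_actions_def by blast
qed

context
  fixes X :: "'x metric" and Y :: "'y metric" and F :: "'x \<Rightarrow> 'x \<Rightarrow> 'y \<Rightarrow> 'y"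
  assumes F: "F \<in> ext_metric_actions X (Aut Y)"
begin

lemma Aut_action_isometry: "\<lbrakk>x \<in> mspace X; x' \<in> mspace X\<rbrakk> \<Longrightarrow> F x x' \<in> isometries Y Y"
  using ext_metric_actions_closed[OF F] by (simp add: Aut_def)

lemma Aut_action_closed:
  "\<lbrakk>x \<in> mspace X; x' \<in> mspace X; y \<in> mspace Y\<rbrakk> \<Longrightarrow> F x x' y \<in> mspace Y"
  using Aut_action_isometry by (rule isometries_apply)

lemma Aut_action_mdist:
  "\<lbrakk>x \<in> mspace X; x' \<in> mspace X; y \<in> mspace Y; y' \<in> mspace Y\<rbrakk> \<Longrightarrow>
    mdist Y (F x x' y) (F x x' y') = mdist Y y y'"
  using Aut_action_isometry by (auto simp: isometries_def)

lemma Aut_action_self: "\<lbrakk>x \<in> mspace X; y \<in> mspace Y\<rbrakk> \<Longrightarrow> F x x y = y"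
  using ext_metric_actions_self[OF F] by (simp add: Aut_def)

lemma Aut_action_inv:
  assumes "x \<in> mspace X" "x' \<in> mspace X" "y \<in> mspace Y"
  shows "F x' x (F x x' y) = y"
proof -
  interpret extended_metric_group "Aut Y" by (rule extended_metric_group_Aut)
  have "F x' x \<otimes>\<^bsub>Aut Y\<^esub> F x x' = \<one>\<^bsub>Aut Y\<^esub>"
    using assms ext_metric_actions_inv[OF F assms(2,1)] ext_metric_actions_closed[OF F] by simp
  then have "compose (mspace Y) (F x' x) (F x x') y = (\<lambda>y\<in>mspace Y. y) y"
    by (simp add: Aut_def)
  then show ?thesis using assms by (simp add: compose_def)
qed

lemma Aut_action_triangle:
  assumes "x \<in> mspace X" "x' \<in> mspace X" "x'' \<in> mspace X" "y \<in> mspace Y"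
  shows "mdist Y (F x' x'' (F x x' y)) (F x x'' y) \<le> mdist X x x' + mdist X x' x'' - mdist X x x''"
  using ext_metric_actions_edist[OF F assms(1-3)] mdist_triangle[OF assms(1-3)] assms(4)
  by (subst (asm) edist_Aut_le_iff) (auto simp: Aut_def compose_def)

end

text \<open>A chart exhibits a fibration as the product \<open>X \<times> Y\<close> with the metric twisted by \<open>F\<close>.\<close>

definition fibration_chart ::
  "'x metric \<Rightarrow> 'y metric \<Rightarrow> ('x \<Rightarrow> 'x \<Rightarrow> 'y \<Rightarrow> 'y) \<Rightarrow> ('x, 'e) fibration \<Rightarrow> ('x \<Rightarrow> 'y \<Rightarrow> 'e) \<Rightarrow> bool" where
  "fibration_chart X Y F p \<alpha> \<longleftrightarrow>
     snd p \<in> extensional (mspace (fst p)) \<and>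
     bij_betw (case_prod \<alpha>) (mspace X \<times> mspace Y) (mspace (fst p)) \<and>
     (\<forall>x\<in>mspace X. \<forall>y\<in>mspace Y. snd p (\<alpha> x y) = x) \<and>
     (\<forall>x\<in>mspace X. \<forall>y\<in>mspace Y. \<forall>x'\<in>mspace X. \<forall>y'\<in>mspace Y.
        mdist (fst p) (\<alpha> x y) (\<alpha> x' y') = mdist X x x' + mdist Y (F x x' y) y')"

context
  fixes X :: "'x metric" and Y :: "'y metric" and F :: "'x \<Rightarrow> 'x \<Rightarrow> 'y \<Rightarrow> 'y"
    and E :: "'e metric" and \<pi> :: "'e \<Rightarrow> 'x" and \<alpha> :: "'x \<Rightarrow> 'y \<Rightarrow> 'e"
  assumes \<alpha>: "fibration_chart X Y F (E, \<pi>) \<alpha>"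
begin

lemma chart_in: "\<lbrakk>x \<in> mspace X; y \<in> mspace Y\<rbrakk> \<Longrightarrow> \<alpha> x y \<in> mspace E"
  using \<alpha> by (auto simp: fibration_chart_def bij_betw_def)

lemma chart_cases:
  assumes "\<epsilon> \<in> mspace E"
  obtains x y where "x \<in> mspace X" "y \<in> mspace Y" "\<epsilon> = \<alpha> x y"
proof -
  have "\<epsilon> \<in> case_prod \<alpha> ` (mspace X \<times> mspace Y)"
    using \<alpha> assms by (simp add: fibration_chart_def bij_betw_def)
  then show ?thesis using that by auto
qed

lemma chart_proj: "\<lbrakk>x \<in> mspace X; y \<in> mspace Y\<rbrakk> \<Longrightarrow> \<pi> (\<alpha> x y) = x"
  using \<alpha> by (simp add: fibration_chart_def)

lemma chart_inject:
  "\<lbrakk>x \<in> mspace X; y \<in> mspace Y; x' \<in> mspace X; y' \<in> mspace Y\<rbrakk> \<Longrightarrow>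
    \<alpha> x y = \<alpha> x' y' \<longleftrightarrow> x = x' \<and> y = y'"
  using \<alpha> inj_onD[of "case_prod \<alpha>" "mspace X \<times> mspace Y" "(x, y)" "(x', y')"]
  by (auto simp: fibration_chart_def bij_betw_def)

lemma chart_mdist:
  "\<lbrakk>x \<in> mspace X; y \<in> mspace Y; x' \<in> mspace X; y' \<in> mspace Y\<rbrakk> \<Longrightarrow>
    mdist E (\<alpha> x y) (\<alpha> x' y') = mdist X x x' + mdist Y (F x x' y) y'"
  using \<alpha> by (simp add: fibration_chart_def)

lemma chart_fiber: "x \<in> mspace X \<Longrightarrow> fiber E \<pi> x = \<alpha> x ` mspace Y"
  by (auto simp: fiber_def chart_in chart_proj elim!: chart_cases)

lemma chart_in_Fib:
  assumes F: "F \<in> ext_metric_actions X (Aut Y)"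
  shows "(E, \<pi>) \<in> cat_obj (Fib X Y)"
proof -
  note Y = Aut_action_closed[OF F] and self = Aut_action_self[OF F]
  have "\<pi> \<in> lipschitz_maps E X"
    using \<alpha> by (auto simp: lipschitz_maps_def fibration_chart_def PiE_iff chart_proj chart_mdist
        elim!: chart_cases)
  moreover have "\<exists>!\<epsilon>x. \<epsilon>x \<in> fiber E \<pi> x \<and> mdist E \<epsilon> \<epsilon>x = mdist X (\<pi> \<epsilon>) x \<and>
      (\<forall>\<epsilon>'\<in>fiber E \<pi> x. mdist E \<epsilon> \<epsilon>' = mdist E \<epsilon> \<epsilon>x + mdist E \<epsilon>x \<epsilon>')"
    if "\<epsilon> \<in> mspace E" and x: "x \<in> mspace X" for \<epsilon> x
  proof -
    obtain x0 y0 where e: "x0 \<in> mspace X" "y0 \<in> mspace Y" "\<epsilon> = \<alpha> x0 y0"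
      using \<open>\<epsilon> \<in> mspace E\<close> by (rule chart_cases)
    \<comment> \<open>The nearest point over \<open>x\<close> is found by transporting the coordinate with \<open>F\<close>.\<close>
    show ?thesis
      using e x by (intro ex1I[of _ "\<alpha> x (F x0 x y0)"])
        (auto simp: chart_fiber chart_proj chart_mdist Y self mdist_self)
  qed
  moreover have "isometric (submetric E (fiber E \<pi> x)) Y" if x: "x \<in> mspace X" for x
  proof -
    have "restrict (\<alpha> x) (mspace Y) \<in> isometries Y (submetric E (fiber E \<pi> x))"
    proof -
      have "inj_on (\<alpha> x) (mspace Y)" using x by (auto simp: inj_on_def chart_inject)
      moreover have "mspace (submetric E (fiber E \<pi> x)) = \<alpha> x ` mspace Y"
        using x by (auto simp: chart_fiber[OF x] chart_in)
      ultimately have "bij_betw (\<alpha> x) (mspace Y) (mspace (submetric E (fiber E \<pi> x)))"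
        by (simp add: bij_betw_def)
      then show ?thesis using x by (simp add: isometries_def chart_mdist mdist_self self)
    qed
    then have "isometric Y (submetric E (fiber E \<pi> x))" by (auto simp: isometric_def)
    then show ?thesis by (rule isometric_sym)
  qed
  ultimately show ?thesis by (simp add: Fib_def metric_fibrations_def)
qed

end

section \<open>Every action has a total space and every fibration a chart\<close>

text \<open>The triangle inequality for the twisted metric is the inequality required of an action; symmetry
  holds since \<open>F x x'\<close> is an isometry with inverse \<open>F x' x\<close>.\<close>

lemma exists_total_space:
  fixes \<iota> :: "'x \<times> 'y \<Rightarrow> 'e"
  assumes \<iota>: "inj_on \<iota> (mspace X \<times> mspace Y)" and F: "F \<in> ext_metric_actions X (Aut Y)"
  shows "\<exists>p :: ('x, 'e) fibration. fibration_chart X Y F p (curry \<iota>)"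
proof -
  note Y = Aut_action_closed[OF F]
  let ?B = "mspace X \<times> mspace Y"
  define c where "c = inv_into ?B \<iota>"
  have c: "c (\<iota> (x, y)) = (x, y)" if "x \<in> mspace X" "y \<in> mspace Y" for x y
    using \<iota> that by (simp add: c_def)
  define tw where "tw a b = (mdist X (fst a) (fst b) + mdist Y (F (fst a) (fst b) (snd a)) (snd b))" for a b
  \<comment> \<open>A metric is required to be symmetric off its carrier as well, hence the value \<open>0\<close> there.\<close>
  define d where "d e e' = (if e \<in> \<iota> ` ?B \<and> e' \<in> \<iota> ` ?B then tw (c e) (c e') else 0)" for e e'
  have comm: "tw (x, y) (x', y') = tw (x', y') (x, y)"
    if m: "x \<in> mspace X" "x' \<in> mspace X" "y \<in> mspace Y" "y' \<in> mspace Y" for x x' y y'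
  proof -
    have "mdist Y (F x x' y) y' = mdist Y (F x' x (F x x' y)) (F x' x y')"
      using m by (simp add: Aut_action_mdist[OF F] Y)
    also have "\<dots> = mdist Y (F x' x y') y"
      using m by (simp add: Aut_action_inv[OF F] mdist_commute)
    finally show ?thesis by (simp add: tw_def mdist_commute)
  qed
  have tri: "tw (x, y) (x'', y'') \<le> tw (x, y) (x', y') + tw (x', y') (x'', y'')"
    if m: "x \<in> mspace X" "x' \<in> mspace X" "x'' \<in> mspace X" "y \<in> mspace Y" "y' \<in> mspace Y" "y'' \<in> mspace Y"
    for x x' x'' y y' y''
  proof -
    let ?z = "F x' x'' (F x x' y)"
    have "mdist Y (F x x'' y) y'' \<le> mdist Y (F x x'' y) ?z + mdist Y ?z (F x' x'' y') + mdist Y (F x' x'' y') y''"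
      using m Y mdist_triangle[of "F x x'' y" Y ?z y''] mdist_triangle[of ?z Y "F x' x'' y'" y''] by simp
    also have "mdist Y (F x x'' y) ?z \<le> mdist X x x' + mdist X x' x'' - mdist X x x''"
      using Aut_action_triangle[OF F m(1-4)] by (simp add: mdist_commute)
    also have "mdist Y ?z (F x' x'' y') = mdist Y (F x x' y) y'"
      using m by (simp add: Aut_action_mdist[OF F] Y)
    finally show ?thesis by (simp add: tw_def)
  qed
  have zero: "tw (x, y) (x', y') = 0 \<longleftrightarrow> x = x' \<and> y = y'"
    if m: "x \<in> mspace X" "x' \<in> mspace X" "y \<in> mspace Y" "y' \<in> mspace Y" for x x' y y'
    using m Y by (auto simp: tw_def add_nonneg_eq_0_iff Aut_action_self[OF F])
  interpret Metric_space "\<iota> ` ?B" d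
  proof
    fix a b show "0 \<le> d a b" by (auto simp: d_def tw_def)
    show "d a b = d b a" by (auto simp: d_def c comm)
  next
    fix a b assume "a \<in> \<iota> ` ?B" "b \<in> \<iota> ` ?B"
    then show "d a b = 0 \<longleftrightarrow> a = b"
      using inj_on_eq_iff[OF \<iota>] by (auto simp: d_def c zero)
  next
    fix a b e assume "a \<in> \<iota> ` ?B" "b \<in> \<iota> ` ?B" "e \<in> \<iota> ` ?B"
    then show "d a e \<le> d a b + d b e" by (auto simp: d_def c tri)
  qed
  have "fibration_chart X Y F (metric (\<iota> ` ?B, d), restrict (fst \<circ> c) (\<iota> ` ?B)) (curry \<iota>)"
    using \<iota> by (auto simp: fibration_chart_def bij_betw_def d_def c tw_def)
  then show ?thesis by blast
qed

text \<open>Moving a point to its nearest point in another fiber transports fibers isometrically onto each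
  other. Identifying every fiber with \<open>Y\<close> turns this transport into an action, and the splitting
  of distances in a fibration says that the identifications form a chart.\<close>

lemma exists_chart:
  assumes "(E, \<pi>) \<in> cat_obj (Fib X Y)"
  shows "\<exists>F\<in>ext_metric_actions X (Aut Y). \<exists>\<alpha>. fibration_chart X Y F (E, \<pi>) \<alpha>"
proof -
  have \<pi>: "\<pi> \<in> extensional (mspace E)" "\<And>\<epsilon>. \<epsilon> \<in> mspace E \<Longrightarrow> \<pi> \<epsilon> \<in> mspace X"
    using assms by (auto simp: Fib_def metric_fibrations_def lipschitz_maps_def PiE_iff)
  have "\<forall>\<epsilon>\<in>mspace E. \<forall>x\<in>mspace X. \<exists>\<epsilon>x. \<epsilon>x \<in> fiber E \<pi> x \<and>
             mdist E \<epsilon> \<epsilon>x = mdist X (\<pi> \<epsilon>) x \<and>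
             (\<forall>\<epsilon>'\<in>fiber E \<pi> x. mdist E \<epsilon> \<epsilon>' = mdist E \<epsilon> \<epsilon>x + mdist E \<epsilon>x \<epsilon>')"
  proof (intro ballI)
    fix \<epsilon> x assume "\<epsilon> \<in> mspace E" "x \<in> mspace X"
    then have "\<exists>!\<epsilon>x. \<epsilon>x \<in> fiber E \<pi> x \<and> mdist E \<epsilon> \<epsilon>x = mdist X (\<pi> \<epsilon>) x \<and>
             (\<forall>\<epsilon>'\<in>fiber E \<pi> x. mdist E \<epsilon> \<epsilon>' = mdist E \<epsilon> \<epsilon>x + mdist E \<epsilon>x \<epsilon>')"
      using assms by (simp add: Fib_def metric_fibrations_def)
    then show "\<exists>\<epsilon>x. \<epsilon>x \<in> fiber E \<pi> x \<and> mdist E \<epsilon> \<epsilon>x = mdist X (\<pi> \<epsilon>) x \<and>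
             (\<forall>\<epsilon>'\<in>fiber E \<pi> x. mdist E \<epsilon> \<epsilon>' = mdist E \<epsilon> \<epsilon>x + mdist E \<epsilon>x \<epsilon>')"
      by (rule ex1_implies_ex)
  qed
  then obtain lift where L: "\<forall>\<epsilon>\<in>mspace E. \<forall>x\<in>mspace X. lift \<epsilon> x \<in> fiber E \<pi> x \<and>
             mdist E \<epsilon> (lift \<epsilon> x) = mdist X (\<pi> \<epsilon>) x \<and>
             (\<forall>\<epsilon>'\<in>fiber E \<pi> x. mdist E \<epsilon> \<epsilon>' = mdist E \<epsilon> (lift \<epsilon> x) + mdist E (lift \<epsilon> x) \<epsilon>')"
    by metis
  have lift: "lift \<epsilon> x \<in> mspace E" "\<pi> (lift \<epsilon> x) = x"
    and lift_mdist: "\<And>\<epsilon>'. \<lbrakk>\<epsilon>' \<in> mspace E; \<pi> \<epsilon>' = x\<rbrakk> \<Longrightarrow> mdist E \<epsilon> \<epsilon>' = mdist X (\<pi> \<epsilon>) x + mdist E (lift \<epsilon> x) \<epsilon>'"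
    if "\<epsilon> \<in> mspace E" "x \<in> mspace X" for \<epsilon> x
    using L[rule_format, OF that] unfolding fiber_def by simp_all
  \<comment> \<open>Computing the distance of points in two fibers from either side shows that the two lifts
     between these fibers are adjoint with respect to the metric, hence inverse isometries.\<close>
  have adjoint: "mdist E (lift \<epsilon> (\<pi> \<delta>)) \<delta> = mdist E \<epsilon> (lift \<delta> (\<pi> \<epsilon>))"
    if "\<epsilon> \<in> mspace E" "\<delta> \<in> mspace E" for \<epsilon> \<delta>
    using that \<pi>(2) lift_mdist[of \<epsilon> "\<pi> \<delta>" \<delta>] lift_mdist[of \<delta> "\<pi> \<epsilon>" \<epsilon>]
    by (simp add: mdist_commute)
  have lift_inv: "lift (lift \<epsilon> x) (\<pi> \<epsilon>) = \<epsilon>" if "\<epsilon> \<in> mspace E" "x \<in> mspace X" for \<epsilon> x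
    using adjoint[of \<epsilon> "lift \<epsilon> x"] that lift[OF that] lift[of "lift \<epsilon> x" "\<pi> \<epsilon>"] \<pi>(2)
    by (simp add: mdist_self)
  have lift_isometry: "mdist E (lift \<epsilon> x) (lift \<delta> x) = mdist E \<epsilon> \<delta>"
    if "\<epsilon> \<in> mspace E" "\<delta> \<in> mspace E" "\<pi> \<delta> = \<pi> \<epsilon>" "x \<in> mspace X" for \<epsilon> \<delta> x
    using adjoint[of \<epsilon> "lift \<delta> x"] that lift lift_inv[of \<delta> x] by simp
  have lift_self: "lift \<epsilon> (\<pi> \<epsilon>) = \<epsilon>" if "\<epsilon> \<in> mspace E" for \<epsilon>
  proof -
    note in_X = \<pi>(2)[OF that]
    have "mdist E (lift \<epsilon> (\<pi> \<epsilon>)) \<epsilon> = 0"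
      using lift_mdist[OF that in_X that] mdist_self[OF that] mdist_self[OF in_X] by simp
    then show ?thesis using lift(1)[OF that in_X] that by simp
  qed

  have "\<forall>x\<in>mspace X. \<exists>a. a \<in> isometries Y (submetric E (fiber E \<pi> x))"
  proof
    fix x assume "x \<in> mspace X"
    then have "isometric (submetric E (fiber E \<pi> x)) Y" using assms by (auto simp: Fib_def)
    then have "isometric Y (submetric E (fiber E \<pi> x))" by (rule isometric_sym)
    then show "\<exists>a. a \<in> isometries Y (submetric E (fiber E \<pi> x))" by (auto simp: isometric_def)
  qed
  then obtain \<alpha> where \<alpha>: "\<forall>x\<in>mspace X. \<alpha> x \<in> isometries Y (submetric E (fiber E \<pi> x))" by metis
  have "fiber E \<pi> x \<inter> mspace E = fiber E \<pi> x" for x by (auto simp: fiber_def)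
  with \<alpha> have \<alpha>_bij: "bij_betw (\<alpha> x) (mspace Y) (fiber E \<pi> x)"
    and \<alpha>_mdist: "\<And>y y'. \<lbrakk>y \<in> mspace Y; y' \<in> mspace Y\<rbrakk> \<Longrightarrow> mdist E (\<alpha> x y) (\<alpha> x y') = mdist Y y y'"
    if "x \<in> mspace X" for x
    using that by (auto simp: isometries_def)
  have \<alpha>_in: "\<alpha> x y \<in> mspace E" "\<pi> (\<alpha> x y) = x" if "x \<in> mspace X" "y \<in> mspace Y" for x y
    using bij_betw_apply[OF \<alpha>_bij] that by (auto simp: fiber_def)
  define \<beta> where "\<beta> \<epsilon> = inv_into (mspace Y) (\<alpha> (\<pi> \<epsilon>)) \<epsilon>" for \<epsilon>
  have \<beta>: "\<beta> \<epsilon> \<in> mspace Y" "\<alpha> (\<pi> \<epsilon>) (\<beta> \<epsilon>) = \<epsilon>" if "\<epsilon> \<in> mspace E" for \<epsilon>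
  proof -
    have "\<epsilon> \<in> \<alpha> (\<pi> \<epsilon>) ` mspace Y"
      using \<alpha>_bij[of "\<pi> \<epsilon>"] \<pi>(2)[OF that] that by (auto simp: bij_betw_def fiber_def)
    then show "\<beta> \<epsilon> \<in> mspace Y" "\<alpha> (\<pi> \<epsilon>) (\<beta> \<epsilon>) = \<epsilon>"
      by (auto simp: \<beta>_def inv_into_into f_inv_into_f)
  qed
  have \<beta>\<alpha>: "\<beta> (\<alpha> x y) = y" if "x \<in> mspace X" "y \<in> mspace Y" for x y
    using that \<alpha>_bij[OF that(1)] by (simp add: \<beta>_def \<alpha>_in bij_betw_def)

  define F where "F = (\<lambda>x\<in>mspace X. \<lambda>x'\<in>mspace X. \<lambda>y\<in>mspace Y. \<beta> (lift (\<alpha> x y) x'))"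
  have F_in: "F x x' y \<in> mspace Y" and F_\<alpha>: "\<alpha> x' (F x x' y) = lift (\<alpha> x y) x'"
    if "x \<in> mspace X" "x' \<in> mspace X" "y \<in> mspace Y" for x x' y
    using that \<beta>[of "lift (\<alpha> x y) x'"] by (simp_all add: F_def lift \<alpha>_in)
  have \<alpha>_inj: "y = y'" if "\<alpha> x y = \<alpha> x y'" "x \<in> mspace X" "y \<in> mspace Y" "y' \<in> mspace Y" for x y y'
    using \<beta>\<alpha>[OF that(2,3)] \<beta>\<alpha>[OF that(2,4)] unfolding that(1) by (rule trans[OF sym])
  have F_inv: "F x x' (F x' x y) = y" if "x \<in> mspace X" "x' \<in> mspace X" "y \<in> mspace Y" for x x' y
    using that lift_inv[of "\<alpha> x' y" x]
    by (intro \<alpha>_inj[of x']) (simp_all add: F_in F_\<alpha> \<alpha>_in)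
  have F_mdist: "mdist Y (F x x' y) (F x x' y') = mdist Y y y'"
    if "x \<in> mspace X" "x' \<in> mspace X" "y \<in> mspace Y" "y' \<in> mspace Y" for x x' y y'
  proof -
    have "mdist Y (F x x' y) (F x x' y') = mdist E (lift (\<alpha> x y) x') (lift (\<alpha> x y') x')"
      using that \<alpha>_mdist[of x' "F x x' y" "F x x' y'"] by (simp add: F_in F_\<alpha>)
    also have "\<dots> = mdist Y y y'" using that by (simp add: lift_isometry \<alpha>_in \<alpha>_mdist)
    finally show ?thesis .
  qed
  have "F \<in> ext_metric_actions X (Aut Y)"
  proof (rule Aut_actionsI)
    show "F \<in> extensional (mspace X)" "\<And>x. x \<in> mspace X \<Longrightarrow> F x \<in> extensional (mspace X)"
      by (auto simp: F_def)
  next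
    fix x x' assume x: "x \<in> mspace X" "x' \<in> mspace X"
    have "bij_betw (F x x') (mspace Y) (mspace Y)"
      using x by (intro bij_betwI[where g = "F x' x"]) (auto simp: F_in F_inv)
    then show "F x x' \<in> isometries Y Y"
      using x F_mdist by (simp add: isometries_def) (simp add: F_def)
  next
    fix x y assume "x \<in> mspace X" "y \<in> mspace Y"
    then show "F x x y = y"
      using lift_self[of "\<alpha> x y"] by (intro \<alpha>_inj[of x]) (simp_all add: F_in F_\<alpha> \<alpha>_in)
  next
    fix x x' x'' y assume m: "x \<in> mspace X" "x' \<in> mspace X" "x'' \<in> mspace X" "y \<in> mspace Y"
    let ?e = "\<alpha> x y"
    let ?e' = "lift ?e x'" let ?e'' = "lift ?e' x''"
    have e: "?e \<in> mspace E" "?e' \<in> mspace E" "?e'' \<in> mspace E" "\<pi> ?e = x" "\<pi> ?e' = x'" "\<pi> ?e'' = x''"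
      using m by (simp_all add: \<alpha>_in lift)
    have "mdist Y (F x' x'' (F x x' y)) (F x x'' y) = mdist E ?e'' (lift ?e x'')"
      using m \<alpha>_mdist[of x'' "F x' x'' (F x x' y)" "F x x'' y"] by (simp add: F_in F_\<alpha>)
    also have "\<dots> = mdist E ?e ?e'' - mdist X x x''"
      using lift_mdist[of ?e x'' ?e''] e m by (simp add: mdist_commute)
    also have "mdist E ?e ?e'' \<le> mdist E ?e ?e' + mdist E ?e' ?e''"
      using e by (intro mdist_triangle)
    also have "\<dots> = mdist X x x' + mdist X x' x''"
      using lift_mdist[of ?e x' ?e'] lift_mdist[of ?e' x'' ?e''] e m
      by (simp add: mdist_self)
    finally show "mdist Y (F x' x'' (F x x' y)) (F x x'' y) \<le> mdist X x x' + mdist X x' x'' - mdist X x x''"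
      by simp
  qed (rule F_inv)
  moreover have "fibration_chart X Y F (E, \<pi>) \<alpha>"
    unfolding fibration_chart_def fst_conv snd_conv
  proof (intro conjI ballI \<pi>)
    show "bij_betw (case_prod \<alpha>) (mspace X \<times> mspace Y) (mspace E)"
      by (rule bij_betw_byWitness[where f' = "\<lambda>\<epsilon>. (\<pi> \<epsilon>, \<beta> \<epsilon>)"]) (auto simp: \<alpha>_in \<beta>\<alpha> \<beta> \<pi>)
  next
    fix x y x' y' assume "x \<in> mspace X" "y \<in> mspace Y" "x' \<in> mspace X" "y' \<in> mspace Y"
    then show "mdist E (\<alpha> x y) (\<alpha> x' y') = mdist X x x' + mdist Y (F x x' y) y'"
      using lift_mdist[of "\<alpha> x y" x' "\<alpha> x' y'"] \<alpha>_mdist[of x' "F x x' y" y']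
      by (simp add: \<alpha>_in F_in F_\<alpha>)
  qed (simp add: \<alpha>_in)
  ultimately show ?thesis by blast
qed

section \<open>Transformations are fibered isometries\<close>

lemma is_category_MFib: "is_category (MFib X :: (('x, 'e) fibration, 'e \<Rightarrow> 'e) cat)"
proof -
  have "mdist N (g (f x)) (g (f x')) \<le> mdist L x x'"
    if "\<forall>i\<in>mspace L. f i \<in> mspace M" "x \<in> mspace L" "x' \<in> mspace L"
      "\<forall>x\<in>mspace L. \<forall>x'\<in>mspace L. mdist M (f x) (f x') \<le> mdist L x x'"
      "\<forall>x\<in>mspace M. \<forall>x'\<in>mspace M. mdist N (g x) (g x') \<le> mdist M x x'"
    for L M N :: "'e metric" and f g x x'
    using that by (meson order_trans)
  then show ?thesis
    unfolding is_category_def MFib_def lipschitz_maps_def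
    by (auto simp: PiE_iff compose_def extensional_def fun_eq_iff)
qed

lemma is_category_Fib: "is_category (Fib X Y)"
  unfolding Fib_def
  by (intro is_category_full_subcategory is_category_MFib) (auto simp: MFib_def)

text \<open>Two mutually inverse maps that do not increase distances preserve them.\<close>

lemma Fib_isos_iff:
  "f \<in> cat_isos (Fib X Y) (E, \<pi>) (E', \<pi>') \<longleftrightarrow>
    f \<in> isometries E E' \<and> (\<forall>\<epsilon>\<in>mspace E. \<pi>' (f \<epsilon>) = \<pi> \<epsilon>)"
proof
  assume "f \<in> cat_isos (Fib X Y) (E, \<pi>) (E', \<pi>')"
  then obtain g where f: "f \<in> lipschitz_maps E E'" "\<forall>\<epsilon>\<in>mspace E. \<pi>' (f \<epsilon>) = \<pi> \<epsilon>"
    and g: "g \<in> lipschitz_maps E' E"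
    and gf: "compose (mspace E) g f = (\<lambda>\<epsilon>\<in>mspace E. \<epsilon>)" and fg: "compose (mspace E') f g = (\<lambda>\<epsilon>\<in>mspace E'. \<epsilon>)"
    by (auto simp: cat_isos_def Fib_def MFib_def)
  have gf: "g (f \<epsilon>) = \<epsilon>" if "\<epsilon> \<in> mspace E" for \<epsilon> using fun_cong[OF gf, of \<epsilon>] that by (simp add: compose_def)
  have fg: "f (g \<epsilon>) = \<epsilon>" if "\<epsilon> \<in> mspace E'" for \<epsilon> using fun_cong[OF fg, of \<epsilon>] that by (simp add: compose_def)
  have fm: "f \<in> mspace E \<rightarrow> mspace E'" and gm: "g \<in> mspace E' \<rightarrow> mspace E"
    using f g by (auto simp: lipschitz_maps_def PiE_iff)
  have "bij_betw f (mspace E) (mspace E')"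
    using gf fg by (intro bij_betwI[OF fm gm])
  moreover have "mdist E' (f \<epsilon>) (f \<delta>) = mdist E \<epsilon> \<delta>" if "\<epsilon> \<in> mspace E" "\<delta> \<in> mspace E" for \<epsilon> \<delta>
  proof (rule antisym)
    show "mdist E' (f \<epsilon>) (f \<delta>) \<le> mdist E \<epsilon> \<delta>" using f that by (simp add: lipschitz_maps_def)
    have "mdist E (g (f \<epsilon>)) (g (f \<delta>)) \<le> mdist E' (f \<epsilon>) (f \<delta>)"
      using g fm that by (auto simp: lipschitz_maps_def Pi_iff)
    then show "mdist E \<epsilon> \<delta> \<le> mdist E' (f \<epsilon>) (f \<delta>)" using gf that by simp
  qed
  ultimately show "f \<in> isometries E E' \<and> (\<forall>\<epsilon>\<in>mspace E. \<pi>' (f \<epsilon>) = \<pi> \<epsilon>)"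
    using f by (auto simp: isometries_def lipschitz_maps_def PiE_iff)
next
  assume f: "f \<in> isometries E E' \<and> (\<forall>\<epsilon>\<in>mspace E. \<pi>' (f \<epsilon>) = \<pi> \<epsilon>)"
  then have b: "bij_betw f (mspace E) (mspace E')"
    and d: "\<And>\<epsilon> \<delta>. \<lbrakk>\<epsilon> \<in> mspace E; \<delta> \<in> mspace E\<rbrakk> \<Longrightarrow> mdist E' (f \<epsilon>) (f \<delta>) = mdist E \<epsilon> \<delta>"
    by (auto simp: isometries_def)
  define g where "g = restrict (inv_into (mspace E) f) (mspace E')"
  have g: "g \<epsilon> \<in> mspace E" "f (g \<epsilon>) = \<epsilon>" if "\<epsilon> \<in> mspace E'" for \<epsilon>
    using b that by (auto simp: g_def bij_betw_def inv_into_into f_inv_into_f)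
  have gf: "g (f \<epsilon>) = \<epsilon>" if "\<epsilon> \<in> mspace E" for \<epsilon>
    using b that by (auto simp: g_def bij_betw_def)
  have fm: "f \<epsilon> \<in> mspace E'" if "\<epsilon> \<in> mspace E" for \<epsilon> using b that by (rule bij_betw_apply)
  have "f \<in> lipschitz_maps E E'" using f fm by (auto simp: lipschitz_maps_def isometries_def PiE_iff)
  moreover have "mdist E (g \<epsilon>) (g \<delta>) = mdist E' \<epsilon> \<delta>" if "\<epsilon> \<in> mspace E'" "\<delta> \<in> mspace E'" for \<epsilon> \<delta>
    using d[of "g \<epsilon>" "g \<delta>"] g that by simp
  then have "g \<in> lipschitz_maps E' E"
    using g(1) by (simp add: lipschitz_maps_def PiE_iff) (simp add: g_def)
  moreover have "\<pi> (g \<epsilon>) = \<pi>' \<epsilon>" if "\<epsilon> \<in> mspace E'" for \<epsilon>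
    using f g[OF that] by metis
  ultimately show "f \<in> cat_isos (Fib X Y) (E, \<pi>) (E', \<pi>')"
    using f g fm gf
    by (auto simp: cat_isos_def Fib_def MFib_def compose_def intro!: bexI[of _ g] restrict_ext)
qed

text \<open>In the coordinates of the two charts, \<open>(x, y)\<close> is sent to \<open>(x, \<theta> x y)\<close>.\<close>

definition chart_map ::
  "'x metric \<Rightarrow> 'y metric \<Rightarrow> ('x \<Rightarrow> 'y \<Rightarrow> 'e) \<Rightarrow> ('x \<Rightarrow> 'y \<Rightarrow> 'e) \<Rightarrow> ('x \<Rightarrow> 'y \<Rightarrow> 'y) \<Rightarrow> 'e \<Rightarrow> 'e" where
  "chart_map X Y \<alpha> \<alpha>' \<theta> =
     (\<lambda>\<epsilon>\<in>case_prod \<alpha> ` (mspace X \<times> mspace Y).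
        case inv_into (mspace X \<times> mspace Y) (case_prod \<alpha>) \<epsilon> of (x, y) \<Rightarrow> \<alpha>' x (\<theta> x y))"

context
  fixes X :: "'x metric" and Y :: "'y metric"
    and F :: "'x \<Rightarrow> 'x \<Rightarrow> 'y \<Rightarrow> 'y" and E :: "'e metric" and \<pi> :: "'e \<Rightarrow> 'x" and \<alpha> :: "'x \<Rightarrow> 'y \<Rightarrow> 'e"
  assumes F: "F \<in> ext_metric_actions X (Aut Y)" and \<alpha>: "fibration_chart X Y F (E, \<pi>) \<alpha>"
begin

lemma chart_map_apply:
  assumes "x \<in> mspace X" "y \<in> mspace Y"
  shows "chart_map X Y \<alpha> \<alpha>' \<theta> (\<alpha> x y) = \<alpha>' x (\<theta> x y)"
proof -
  have "inj_on (case_prod \<alpha>) (mspace X \<times> mspace Y)"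
    using \<alpha> by (auto simp: fibration_chart_def bij_betw_def)
  from inv_into_f_f[OF this, of "(x, y)"] show ?thesis
    using assms by (auto simp: chart_map_def)
qed

lemma chart_map_extensional: "chart_map X Y \<alpha> \<alpha>' \<theta> \<in> extensional (mspace E)"
  using \<alpha> by (simp add: chart_map_def fibration_chart_def bij_betw_def)

lemma chart_map_eqI:
  assumes "f \<in> extensional (mspace E)"
    and "\<And>x y. \<lbrakk>x \<in> mspace X; y \<in> mspace Y\<rbrakk> \<Longrightarrow> f (\<alpha> x y) = \<alpha>' x (\<theta> x y)"
  shows "chart_map X Y \<alpha> \<alpha>' \<theta> = f"
  using assms by (intro extensionalityI[OF chart_map_extensional])
    (auto simp: chart_map_apply elim!: chart_cases[OF \<alpha>])

context
  fixes F' :: "'x \<Rightarrow> 'x \<Rightarrow> 'y \<Rightarrow> 'y" and E' :: "'e metric" and \<pi>' :: "'e \<Rightarrow> 'x" and \<alpha>' :: "'x \<Rightarrow> 'y \<Rightarrow> 'e"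
  assumes F': "F' \<in> ext_metric_actions X (Aut Y)" and \<alpha>': "fibration_chart X Y F' (E', \<pi>') \<alpha>'"
begin

lemma chart_map_iso:
  assumes \<theta>: "\<theta> \<in> cat_hom (EPMet X (Aut Y)) F F'"
  shows "chart_map X Y \<alpha> \<alpha>' \<theta> \<in> cat_isos (Fib X Y) (E, \<pi>) (E', \<pi>')"
proof -
  let ?f = "chart_map X Y \<alpha> \<alpha>' \<theta>"
  have \<theta>b: "bij_betw (\<theta> x) (mspace Y) (mspace Y)"
    and \<theta>d: "\<And>y y'. \<lbrakk>y \<in> mspace Y; y' \<in> mspace Y\<rbrakk> \<Longrightarrow> mdist Y (\<theta> x y) (\<theta> x y') = mdist Y y y'"
    if "x \<in> mspace X" for x
    using \<theta> that by (auto simp: EPMet_def Aut_def isometries_def PiE_iff)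
  have \<theta>m: "\<theta> x y \<in> mspace Y" if "x \<in> mspace X" "y \<in> mspace Y" for x y
    using bij_betw_apply[OF \<theta>b] that by blast
  have nat: "F' x x' (\<theta> x y) = \<theta> x' (F x x' y)" if "x \<in> mspace X" "x' \<in> mspace X" "y \<in> mspace Y" for x x' y
  proof -
    have "compose (mspace Y) (F' x x') (\<theta> x) = compose (mspace Y) (\<theta> x') (F x x')"
      using \<theta> that by (auto simp: EPMet_def Aut_def)
    from fun_cong[OF this, of y] show ?thesis using that by (simp add: compose_def)
  qed
  have "\<exists>\<epsilon>\<in>mspace E. ?f \<epsilon> = \<delta>" if "\<delta> \<in> mspace E'" for \<delta>
  proof -
    obtain x z where z: "x \<in> mspace X" "z \<in> mspace Y" "\<delta> = \<alpha>' x z"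
      using \<open>\<delta> \<in> mspace E'\<close> by (rule chart_cases[OF \<alpha>'])
    then have "z \<in> \<theta> x ` mspace Y" using \<theta>b[OF z(1)] by (simp add: bij_betw_def)
    then obtain y where "y \<in> mspace Y" "\<theta> x y = z" by blast
    with z show ?thesis by (intro bexI[of _ "\<alpha> x y"]) (simp_all add: chart_map_apply chart_in[OF \<alpha>])
  qed
  moreover have d: "mdist E' (?f \<epsilon>) (?f \<delta>) = mdist E \<epsilon> \<delta>" if "\<epsilon> \<in> mspace E" "\<delta> \<in> mspace E" for \<epsilon> \<delta>
    using that by (auto simp: chart_map_apply chart_mdist[OF \<alpha>] chart_mdist[OF \<alpha>'] \<theta>m \<theta>d nat
        Aut_action_closed[OF F] elim!: chart_cases[OF \<alpha>])
  moreover have m: "?f \<epsilon> \<in> mspace E'" "\<pi>' (?f \<epsilon>) = \<pi> \<epsilon>" if "\<epsilon> \<in> mspace E" for \<epsilon>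
    using that by (auto simp: chart_map_apply \<theta>m chart_in[OF \<alpha>'] chart_proj[OF \<alpha>] chart_proj[OF \<alpha>']
        elim!: chart_cases[OF \<alpha>])
  moreover have "inj_on ?f (mspace E)"
  proof (rule inj_onI)
    fix \<epsilon> \<delta> assume *: "\<epsilon> \<in> mspace E" "\<delta> \<in> mspace E" "?f \<epsilon> = ?f \<delta>"
    then have "mdist E \<epsilon> \<delta> = 0" using d[of \<epsilon> \<delta>] m(1)[of \<delta>] by (simp add: mdist_self)
    then show "\<epsilon> = \<delta>" using * by simp
  qed
  ultimately have "bij_betw ?f (mspace E) (mspace E')" unfolding bij_betw_def by blast
  then show ?thesis
    using d m by (auto simp: Fib_isos_iff isometries_def chart_map_extensional)
qed

text \<open>A map over \<open>X\<close> acts on coordinates by some \<open>\<theta>\<close>. Preservation of the distance from \<open>(x, y)\<close> to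
  \<open>(x', y')\<close> makes \<open>\<theta> x\<close> an isometry when \<open>x = x'\<close>, and gives naturality when \<open>y' = F x x' y\<close>,
  for then the fiber part of the distance vanishes.\<close>

lemma chart_map_surj:
  assumes f: "f \<in> cat_isos (Fib X Y) (E, \<pi>) (E', \<pi>')"
  shows "\<exists>\<theta>\<in>cat_hom (EPMet X (Aut Y)) F F'. chart_map X Y \<alpha> \<alpha>' \<theta> = f"
proof -
  have fi: "f \<in> extensional (mspace E)" "bij_betw f (mspace E) (mspace E')"
    and fd: "\<And>\<epsilon> \<delta>. \<lbrakk>\<epsilon> \<in> mspace E; \<delta> \<in> mspace E\<rbrakk> \<Longrightarrow> mdist E' (f \<epsilon>) (f \<delta>) = mdist E \<epsilon> \<delta>"
    and f\<pi>: "\<And>\<epsilon>. \<epsilon> \<in> mspace E \<Longrightarrow> \<pi>' (f \<epsilon>) = \<pi> \<epsilon>"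
    using f by (auto simp: Fib_isos_iff isometries_def)
  have "\<forall>x\<in>mspace X. \<forall>y\<in>mspace Y. \<exists>z\<in>mspace Y. f (\<alpha> x y) = \<alpha>' x z"
  proof (intro ballI)
    fix x y assume m: "x \<in> mspace X" "y \<in> mspace Y"
    then have "f (\<alpha> x y) \<in> fiber E' \<pi>' x"
      using bij_betw_apply[OF fi(2)] by (simp add: fiber_def chart_in[OF \<alpha>] f\<pi> chart_proj[OF \<alpha>])
    then show "\<exists>z\<in>mspace Y. f (\<alpha> x y) = \<alpha>' x z" using m by (auto simp: chart_fiber[OF \<alpha>'])
  qed
  then obtain t where t: "\<forall>x\<in>mspace X. \<forall>y\<in>mspace Y. t x y \<in> mspace Y \<and> f (\<alpha> x y) = \<alpha>' x (t x y)"
    by metis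
  define \<theta> where "\<theta> = (\<lambda>x\<in>mspace X. \<lambda>y\<in>mspace Y. t x y)"
  have \<theta>: "\<theta> x y \<in> mspace Y" "f (\<alpha> x y) = \<alpha>' x (\<theta> x y)" if "x \<in> mspace X" "y \<in> mspace Y" for x y
    using t that by (simp_all add: \<theta>_def)
  have key: "mdist Y (F' x x' (\<theta> x y)) (\<theta> x' y') = mdist Y (F x x' y) y'"
    if "x \<in> mspace X" "x' \<in> mspace X" "y \<in> mspace Y" "y' \<in> mspace Y" for x x' y y'
    using fd[of "\<alpha> x y" "\<alpha> x' y'"] that
    by (simp add: chart_in[OF \<alpha>] \<theta> chart_mdist[OF \<alpha>] chart_mdist[OF \<alpha>'])
  have \<theta>d: "mdist Y (\<theta> x y) (\<theta> x y') = mdist Y y y'" if "x \<in> mspace X" "y \<in> mspace Y" "y' \<in> mspace Y" for x y y'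
    using key[of x x y y'] that by (simp add: \<theta> Aut_action_self[OF F] Aut_action_self[OF F'])
  have iso: "\<theta> x \<in> isometries Y Y" if x: "x \<in> mspace X" for x
  proof -
    have "\<exists>y\<in>mspace Y. \<theta> x y = z" if z: "z \<in> mspace Y" for z
    proof -
      have "\<alpha>' x z \<in> f ` mspace E" using fi(2) x z by (simp add: bij_betw_def chart_in[OF \<alpha>'])
      then obtain x' y where y: "x' \<in> mspace X" "y \<in> mspace Y" "\<alpha>' x z = f (\<alpha> x' y)"
        by (auto elim!: chart_cases[OF \<alpha>])
      then show ?thesis using x z \<theta>[of x' y] chart_inject[OF \<alpha>', of x z x' "\<theta> x' y"] by auto
    qed
    moreover have "inj_on (\<theta> x) (mspace Y)"
    proof (rule inj_onI)
      fix y y' assume *: "y \<in> mspace Y" "y' \<in> mspace Y" "\<theta> x y = \<theta> x y'"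
      have "mdist Y y y' = mdist Y (\<theta> x y') (\<theta> x y')" using \<theta>d[OF x *(1,2)] *(3) by simp
      then have "mdist Y y y' = 0" using \<theta>(1)[OF x *(2)] by (simp add: mdist_self)
      then show "y = y'" using *(1,2) by simp
    qed
    ultimately have "bij_betw (\<theta> x) (mspace Y) (mspace Y)"
      using \<theta>(1) x unfolding bij_betw_def by blast
    then show ?thesis using x \<theta>d by (simp add: isometries_def) (simp add: \<theta>_def)
  qed
  have "compose (mspace Y) (F' x x') (\<theta> x) = compose (mspace Y) (\<theta> x') (F x x')"
    if "x \<in> mspace X" "x' \<in> mspace X" for x x'
  proof -
    have "F' x x' (\<theta> x y) = \<theta> x' (F x x' y)" if y: "y \<in> mspace Y" for y
    proof -
      have m: "F x x' y \<in> mspace Y" "F' x x' (\<theta> x y) \<in> mspace Y"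
        using y \<open>x \<in> _\<close> \<open>x' \<in> _\<close> by (simp_all add: \<theta> Aut_action_closed[OF F] Aut_action_closed[OF F'])
      then have "mdist Y (F' x x' (\<theta> x y)) (\<theta> x' (F x x' y)) = 0"
        using key[of x x' y "F x x' y"] y \<open>x \<in> _\<close> \<open>x' \<in> _\<close> by simp
      then show ?thesis using m \<theta>(1) \<open>x' \<in> _\<close> by simp
    qed
    then show ?thesis by (simp add: compose_def restrict_def fun_eq_iff)
  qed
  then have "\<theta> \<in> cat_hom (EPMet X (Aut Y)) F F'"
    using iso by (simp add: EPMet_def Aut_def PiE_iff) (simp add: \<theta>_def)
  moreover have "chart_map X Y \<alpha> \<alpha>' \<theta> = f" using fi(1) \<theta>(2) by (rule chart_map_eqI)
  ultimately show ?thesis by blast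
qed

lemma bij_betw_chart_map:
  "bij_betw (chart_map X Y \<alpha> \<alpha>') (cat_hom (EPMet X (Aut Y)) F F') (cat_isos (Fib X Y) (E, \<pi>) (E', \<pi>'))"
  unfolding bij_betw_def
proof (intro conjI inj_onI)
  fix \<theta> \<eta> assume *: "\<theta> \<in> cat_hom (EPMet X (Aut Y)) F F'" "\<eta> \<in> cat_hom (EPMet X (Aut Y)) F F'"
    "chart_map X Y \<alpha> \<alpha>' \<theta> = chart_map X Y \<alpha> \<alpha>' \<eta>"
  have iso: "\<theta> x \<in> isometries Y Y" "\<eta> x \<in> isometries Y Y" if "x \<in> mspace X" for x
    using * that by (auto simp: EPMet_def Aut_def PiE_iff)
  have "\<theta> x y = \<eta> x y" if "x \<in> mspace X" "y \<in> mspace Y" for x y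
  proof -
    have "\<alpha>' x (\<theta> x y) = \<alpha>' x (\<eta> x y)"
      using fun_cong[OF *(3), of "\<alpha> x y"] that by (simp add: chart_map_apply)
    moreover have "\<theta> x y \<in> mspace Y" "\<eta> x y \<in> mspace Y"
      using isometries_apply[OF iso(1)] isometries_apply[OF iso(2)] that by simp_all
    ultimately show ?thesis using that by (simp add: chart_inject[OF \<alpha>'])
  qed
  then have "\<theta> x = \<eta> x" if "x \<in> mspace X" for x
    using iso that by (intro extensionalityI[of _ "mspace Y"]) (auto simp: isometries_def)
  then show "\<theta> = \<eta>"
    using * by (intro extensionalityI[of _ "mspace X"]) (auto simp: EPMet_def PiE_iff)
next
  show "chart_map X Y \<alpha> \<alpha>' ` cat_hom (EPMet X (Aut Y)) F F' = cat_isos (Fib X Y) (E, \<pi>) (E', \<pi>')"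
    using chart_map_iso chart_map_surj by blast
qed

end

end

text \<open>The total space of an action comes with a chart for the same action. If another fibration has
  a chart for this action, the identity transformation gives an isomorphism between the two, so
  essential surjectivity is a case of the correspondence between transformations and isomorphisms.\<close>

lemma equivalence_functor_total_space:
  fixes X :: "'x metric" and Y :: "'y metric"
  assumes universe: "mspace X \<times> mspace Y \<lesssim> (UNIV :: 'e set)"
  shows "\<exists>T Tm. equivalence_functor (EPMet X (Aut Y))
           (core (Fib X Y :: (('x, 'e) fibration, 'e \<Rightarrow> 'e) cat)) T Tm"
proof -
  interpret extended_metric_group "Aut Y" by (rule extended_metric_group_Aut)
  let ?A = "ext_metric_actions X (Aut Y)" and ?E = "EPMet X (Aut Y)"
  let ?Fib = "Fib X Y :: (('x, 'e) fibration, 'e \<Rightarrow> 'e) cat"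
  obtain \<iota> :: "'x \<times> 'y \<Rightarrow> 'e" where \<iota>: "inj_on \<iota> (mspace X \<times> mspace Y)"
    using universe by (auto simp: lepoll_def)
  define \<alpha> where "\<alpha> = curry \<iota>"
  obtain T :: "_ \<Rightarrow> ('x, 'e) fibration" where T: "\<And>F. F \<in> ?A \<Longrightarrow> fibration_chart X Y F (T F) \<alpha>"
    using exists_total_space[OF \<iota>] unfolding \<alpha>_def by metis
  define Tm :: "('x \<Rightarrow> 'x \<Rightarrow> 'y \<Rightarrow> 'y) \<Rightarrow> ('x \<Rightarrow> 'x \<Rightarrow> 'y \<Rightarrow> 'y) \<Rightarrow> _"
    where "Tm F F' = chart_map X Y \<alpha> \<alpha>" for F F'
  have T': "fibration_chart X Y F (fst (T F), snd (T F)) \<alpha>" if "F \<in> ?A" for F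
    using T[OF that] by simp
  have obj: "T F \<in> cat_obj ?Fib" if "F \<in> ?A" for F
    using chart_in_Fib[OF T'[OF that] that] by simp
  have bij: "bij_betw (Tm F F') (cat_hom ?E F F') (cat_isos ?Fib (T F) (T F'))"
    if "F \<in> ?A" "F' \<in> ?A" for F F'
    using bij_betw_chart_map[OF that(1) T'[OF that(1)] that(2) T'[OF that(2)]] by (simp add: Tm_def)
  have id: "cat_id ?Fib p = (\<lambda>\<epsilon>\<in>mspace (fst p). \<epsilon>)" for p
    by (simp add: Fib_def MFib_def case_prod_beta)
  have comp: "cat_comp ?Fib p p' p'' g f = compose (mspace (fst p)) g f" for p p' p'' g f
    by (simp add: Fib_def MFib_def case_prod_beta)
  have "is_functor ?E (core ?Fib) T Tm"
    unfolding is_functor_def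
  proof (intro conjI ballI is_category_EPMet is_group is_category_core is_category_Fib)
    fix F assume "F \<in> cat_obj ?E"
    then have F: "F \<in> ?A" by (simp add: EPMet_def)
    then show "T F \<in> cat_obj (core ?Fib)" using obj by (simp add: core_def)
    show "Tm F F (cat_id ?E F) = cat_id (core ?Fib) (T F)"
      unfolding Tm_def using chart_in[OF T'[OF F]]
      by (intro chart_map_eqI[OF F T'[OF F]]) (auto simp: core_def id EPMet_def Aut_def)
  next
    fix F F' \<theta> assume "F \<in> cat_obj ?E" "F' \<in> cat_obj ?E" "\<theta> \<in> cat_hom ?E F F'"
    then show "Tm F F' \<theta> \<in> cat_hom (core ?Fib) (T F) (T F')"
      using bij[of F F'] by (simp add: EPMet_def core_def bij_betw_apply)
  next
    fix F F' F'' \<theta> \<eta>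
    assume "F \<in> cat_obj ?E" "F' \<in> cat_obj ?E" and \<theta>: "\<theta> \<in> cat_hom ?E F F'"
    then have F: "F \<in> ?A" "F' \<in> ?A" by (simp_all add: EPMet_def)
    have "\<theta> x y \<in> mspace Y" if "x \<in> mspace X" "y \<in> mspace Y" for x y
      using \<theta> that by (auto simp: EPMet_def Aut_def isometries_def PiE_iff bij_betw_apply)
    then show "Tm F F'' (cat_comp ?E F F' F'' \<eta> \<theta>) =
        cat_comp (core ?Fib) (T F) (T F') (T F'') (Tm F' F'' \<eta>) (Tm F F' \<theta>)"
      unfolding Tm_def using chart_in[OF T'[OF F(1)]]
      by (intro chart_map_eqI[OF F(1) T'[OF F(1)]])
        (simp_all add: core_def comp compose_def EPMet_def Aut_def
          chart_map_apply[OF F(1) T'[OF F(1)]] chart_map_apply[OF F(2) T'[OF F(2)]])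
  qed
  moreover have "\<exists>F\<in>?A. cat_isos (core ?Fib) (T F) p \<noteq> {}" if "p \<in> cat_obj ?Fib" for p
  proof -
    obtain E \<pi> where p: "p = (E, \<pi>)" by (cases p)
    then obtain F \<alpha>' where F: "F \<in> ?A" and \<alpha>': "fibration_chart X Y F (E, \<pi>) \<alpha>'"
      using exists_chart[of E \<pi> X Y] \<open>p \<in> cat_obj ?Fib\<close> by blast
    have "cat_id ?E F \<in> cat_hom ?E F F"
      using is_category_EPMet[OF is_group] F by (intro category_id) (auto simp: EPMet_def)
    from chart_map_iso[OF F T'[OF F] F \<alpha>' this] show ?thesis
      using F p by (auto simp: cat_isos_core)
  qed
  ultimately have "equivalence_functor ?E (core ?Fib) T Tm"
    using bij by (simp add: equivalence_functor_def) (simp add: EPMet_def core_def)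
  then show ?thesis by blast
qed

theorem proposition6p18:
  fixes X :: "'x metric" and Y :: "'y metric"
  assumes universe: "mspace X \<times> mspace Y \<lesssim> (UNIV :: 'e set)"
  shows "equivalent_categories (EPMet X (Aut Y))
           (core (Fib X Y :: (('x, 'e) fibration, 'e \<Rightarrow> 'e) cat)) \<and>
         (\<forall>x\<^sub>0\<in>mspace X.
           equivalent_categories (core (Fib X Y :: (('x, 'e) fibration, 'e \<Rightarrow> 'e) cat))
             (Hom (pi1m X x\<^sub>0) (Aut Y)))"
proof -
  obtain T Tm where T: "equivalence_functor (EPMet X (Aut Y))
      (core (Fib X Y :: (('x, 'e) fibration, 'e \<Rightarrow> 'e) cat)) T Tm"
    using equivalence_functor_total_space[OF universe] by blast
  have "equivalent_categories (core (Fib X Y :: (('x, 'e) fibration, 'e \<Rightarrow> 'e) cat))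
      (Hom (pi1m X x\<^sub>0) (Aut Y))" if "x\<^sub>0 \<in> mspace X" for x\<^sub>0
    by (rule equivalent_categories_sym[OF equivalence_functor_imp_equivalent_categories[OF
          equivalence_functor_comp[OF equivalence_functor_loop_action[OF that extended_metric_group_Aut] T]]])
  then show ?thesis
    by (intro conjI ballI equivalence_functor_imp_equivalent_categories[OF T])
qed

end
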